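(* Let $B$ be a complex Banach space. For every $r\in\,]0,e^{-3\alpha}[$ and every $a\in\mathcal S(r,B)$, the Borel-Wolff-Denjoy series $\Sigma_{\mathcal R}(a)$ belongs to the space of monogenic functions $\mathcal M((K_j),B)$. In particular, if $0<r_2<r_1e^{-3\alpha}$ and $B=\mathcal L(B_{r_1},B_{r_2})$, then the general solution $F_{r_1,r_2}$ of the cohomological equation $f(qz)-f(z)=g(z)$ belongs to $\mathcal M((K_j),\mathcal L(B_{r_1},B_{r_2}))$.
   Context: **Roots of unity.** $\mathbb D=\{|q|<1\}$, $\mathbb E=\{|q|>1\}$, $\mathbb S^1=\{|q|=1\}$, $\mathbb D_r=\{|z|<r\}$. $\mathcal R$ is the set of all complex roots of unity; for $\Lambda\in\mathcal R$, $m(\Lambda)=\min\{m\ge1:\Lambda^m=1\}$. **Borel-Wolff-Denjoy series.** For $r\in\,]0,1[$, $\mathcal S(r,B)$ is the set of families $a=(a_\Lambda)_{\Lambda\in\mathcal R}$ in $B$ for which there is $c>0$ with $\|a_\Lambda\|\le c\,r^{m(\Lambda)}/m(\Lambda)$ for all $\Lambda$. For such $a$, $(\Sigma_{\mathcal R}(a))(q)=\sum_{\Lambda\in\mathcal R}\frac{a_\Lambda}{q-\Lambda}$. **General solution.** $B_r=\{\varphi\in H^\infty(\mathbb D_r):\varphi(0)=0\}$ with the sup norm (bounded holomorphic functions on $\mathbb D_r$ vanishing at $0$). The Hadamard product is $(\sum A_nz^n)\odot(\sum B_nz^n)=\sum A_nB_nz^n$. $\mathcal L(B_{r_1},B_{r_2})$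 is the space of bounded linear operators. For $0<r_2<r_1$ and $q\in\mathbb D\cup\mathbb E$, $F_{r_1,r_2}(q)\in\mathcal L(B_{r_1},B_{r_2})$ is $g=\sum_{n\ge1}g_nz^n\mapsto\sum_{n\ge1}g_n\frac{z^n}{q^n-1}$, the unique solution vanishing at $0$ of $f(qz)-f(z)=g(z)$. With $\mathcal L_m(z)=-\frac1m\log(1-z^m)$, one has $F_{r_1,r_2}=\Sigma_{\mathcal R}(a)$ for $a_\Lambda=\Lambda\,\mathcal L_{m(\Lambda)}\odot\,$ (the operator $g\mapsto\Lambda\,\mathcal L_{m(\Lambda)}\odot g$); this series is also used to define $F_{r_1,r_2}$ at the points of $\mathbb S^1\cap\bigcup_jK_j$. **The compact sets $K_j$.** An irrational class $x\in(\mathbb R\setminus\mathbb Q)/\mathbb Z$ is represented in $]0,1[$ as $x=[0,a_1,a_2,\dots]$ with convergents $n_k(x)/m_k(x)=[0,a_1,\dots,a_k]$ in lowest terms, $k\ge0$ ($n_0/m_0=0/1$). For a decreasing function $\psi:\mathbb N^*\to\mathbb R$ with $2\sum_{m\ge1}\psi(m)<1$ and $0<\psi(m)\le\frac1{2m}$ (an approximation function), set $C_\psi=\{x\in(\mathbb R\setminus\mathbb Q)/\mathbb Z:\ m_{k+1}(x)\le 1/\psi(m_k(x))\ \forall k\ge0\}$, and for $\kappa\in\,]0,1[$, $d>0$, let $C_{\psi,\kappa,d}\subset\mathbb C/\mathbb Z$ be the set of classes of those $\tilde x\in\mathbb C$ for which there is a lift $\tilde y\in\mathbb R$ of a point of $C_\psi$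 with $\kappa|\mathrm{Re}(\tilde x-\tilde y)|\le|\mathrm{Im}\,\tilde x|\le d$. Fix $\kappa\in\,]0,1[$, $d,\alpha>0$ and a decreasing sequence of positive numbers $(\gamma_j)_{j\ge0}$ tending to $0$ with $\gamma_j<\inf(\frac{\alpha e}2,\frac{e^\alpha-1}2,1)$. Then $\psi_j(m)=\gamma_je^{-\alpha m}$ is an approximation function, and $K_j=\{e^{2\pi ix}:x\in C_{\psi_j,\kappa,d}\}$; $(K_j)$ is an increasing sequence of compact subsets of $\mathbb C$. **Monogenic functions.** For $C\subset\mathbb C$ closed, a continuous $f:C\to B$ is $\mathcal C^1$-holomorphic if there is a continuous $f^{(1)}:C\to B$ such that for all $z\in C$, $\varepsilon>0$ there is $\delta>0$ with $\|f(z_2)-f(z_1)-f^{(1)}(z_1)(z_2-z_1)\|\le\varepsilon|z_1-z_2|$ for all $z_1,z_2\in C$ with $|z_1-z|<\delta$, $|z_2-z|<\delta$. $\mathcal C^1_{hol}(K,B)$ is the space of such functions on a compact $K$. $\mathcal M((K_j),B)=\varprojlim\mathcal C^1_{hol}(K_j,B)$, i.e. the functions on $\bigcup_jK_j$ whose restriction to each $K_j$ is in $\mathcal C^1_{hol}(K_j,B)$. *)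

theory Defs
  imports "HOL-Complex_Analysis.Complex_Analysis" "HOL-Library.Function_Algebras"
begin

text \<open>
  Complex Banach spaces are given by explicit carriers, because the radii in
  \<open>L(B\<^bsub>r1\<^esub>, B\<^bsub>r2\<^esub>)\<close> are variables and cannot be turned into types.
  A space is a subspace \<open>vecs\<close> of an ambient complex vector space (whose addition is that
  of the type) together with a norm, of which only the values on \<open>vecs\<close> matter.
\<close>

record 'b nspace =
  vecs :: "'b set"
  scl :: "complex \<Rightarrow> 'b \<Rightarrow> 'b"
  nrm :: "'b \<Rightarrow> real"

definition complex_normed :: "'b::ab_group_add nspace \<Rightarrow> bool" where
  "complex_normed E \<longleftrightarrow>
     vector_space (scl E) \<and> module.subspace (scl E) (vecs E) \<and>
     (\<forall>x\<in>vecs E. 0 \<le> nrm E x) \<and>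
     (\<forall>x\<in>vecs E. nrm E x = 0 \<longleftrightarrow> x = 0) \<and>
     (\<forall>x\<in>vecs E. \<forall>y\<in>vecs E. nrm E (x + y) \<le> nrm E x + nrm E y) \<and>
     (\<forall>c. \<forall>x\<in>vecs E. nrm E (scl E c x) = cmod c * nrm E x)"

text \<open>The guard is needed since the locale \<open>Metric_space\<close> asks for nonnegativity and symmetry
  outside the carrier as well.\<close>

definition ndist :: "'b::ab_group_add nspace \<Rightarrow> 'b \<Rightarrow> 'b \<Rightarrow> real" where
  "ndist E x y = (if x \<in> vecs E \<and> y \<in> vecs E then nrm E (x - y) else 0)"

abbreviation ntopology :: "'b::ab_group_add nspace \<Rightarrow> 'b topology" where
  "ntopology E \<equiv> Metric_space.mtopology (vecs E) (ndist E)"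

definition complex_banach :: "'b::ab_group_add nspace \<Rightarrow> bool" where
  "complex_banach E \<longleftrightarrow>
     complex_normed E \<and> Metric_space.mcomplete (vecs E) (ndist E)"

text \<open>Bounded linear operators with the operator norm (the convention \<open>0 / 0 = 0\<close> takes care
  of the zero vector, as for \<open>onorm\<close>). The operators are extended by \<open>0\<close> outside the carrier
  of \<open>E\<close>, so that equality of operators is equality of functions.\<close>

definition bounded_ops ::
    "'a::ab_group_add nspace \<Rightarrow> 'b::ab_group_add nspace \<Rightarrow> ('a \<Rightarrow> 'b) nspace" where
  "bounded_ops E G =
     \<lparr>vecs = {T. (\<forall>x\<in>vecs E. T x \<in> vecs G) \<and>
                 (\<forall>x\<in>vecs E. \<forall>y\<in>vecs E. T (x + y) = T x + T y) \<and>
                 (\<forall>c. \<forall>x\<in>vecs E. T (scl E c x) = scl G c (T x)) \<and>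
                 (\<exists>M. \<forall>x\<in>vecs E. nrm G (T x) \<le> M * nrm E x) \<and>
                 (\<forall>x. x \<notin> vecs E \<longrightarrow> T x = 0)},
      scl = (\<lambda>c T x. scl G c (T x)),
      nrm = (\<lambda>T. SUP x\<in>vecs E. nrm G (T x) / nrm E x)\<rparr>"


section \<open>Borel-Wolff-Denjoy series\<close>

definition roots_of_unity :: "complex set" where
  "roots_of_unity = {\<Lambda>. \<exists>m\<ge>1. \<Lambda> ^ m = 1}"

definition root_order :: "complex \<Rightarrow> nat" where
  "root_order \<Lambda> = (LEAST m. m \<ge> 1 \<and> \<Lambda> ^ m = 1)"

definition S_space :: "real \<Rightarrow> 'b::ab_group_add nspace \<Rightarrow> (complex \<Rightarrow> 'b) set" where
  "S_space r E = {a. (\<forall>\<Lambda>\<in>roots_of_unity. a \<Lambda> \<in> vecs E) \<and>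
     (\<exists>c>0. \<forall>\<Lambda>\<in>roots_of_unity.
        nrm E (a \<Lambda>) \<le> c * r ^ root_order \<Lambda> / real (root_order \<Lambda>))}"

definition bwd_has_sum ::
    "'b::ab_group_add nspace \<Rightarrow> (complex \<Rightarrow> 'b) \<Rightarrow> complex \<Rightarrow> 'b \<Rightarrow> bool" where
  "bwd_has_sum E a q s \<longleftrightarrow>
     limitin (ntopology E) (\<lambda>X. \<Sum>\<Lambda>\<in>X. scl E (1 / (q - \<Lambda>)) (a \<Lambda>)) s
       (finite_subsets_at_top roots_of_unity)"

definition bwd_sum :: "'b::ab_group_add nspace \<Rightarrow> (complex \<Rightarrow> 'b) \<Rightarrow> complex \<Rightarrow> 'b" where
  "bwd_sum E a q = (THE s. bwd_has_sum E a q s)"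


section \<open>The general solution of the cohomological equation\<close>

text \<open>Functions on the open disk of radius \<open>r\<close> are represented by their extension by \<open>0\<close>.\<close>

definition Hinf0 :: "real \<Rightarrow> (complex \<Rightarrow> complex) nspace" where
  "Hinf0 r =
     \<lparr>vecs = {g. g holomorphic_on ball 0 r \<and> bounded (g ` ball 0 r) \<and> g 0 = 0 \<and>
                 (\<forall>z. z \<notin> ball 0 r \<longrightarrow> g z = 0)},
      scl = (\<lambda>c g z. c * g z),
      nrm = (\<lambda>g. SUP z\<in>ball 0 r. cmod (g z))\<rparr>"

abbreviation L_space ::
    "real \<Rightarrow> real \<Rightarrow> ((complex \<Rightarrow> complex) \<Rightarrow> complex \<Rightarrow> complex) nspace" where
  "L_space r1 r2 \<equiv> bounded_ops (Hinf0 r1) (Hinf0 r2)"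

definition hadamard :: "complex fps \<Rightarrow> complex fps \<Rightarrow> complex fps" where
  "hadamard A B = Abs_fps (\<lambda>n. fps_nth A n * fps_nth B n)"

definition fps_op ::
    "real \<Rightarrow> real \<Rightarrow> (complex fps \<Rightarrow> complex fps) \<Rightarrow> (complex \<Rightarrow> complex) \<Rightarrow> complex \<Rightarrow> complex" where
  "fps_op r1 r2 \<Phi> g =
     (if g \<in> vecs (Hinf0 r1)
      then (\<lambda>z. if z \<in> ball 0 r2 then eval_fps (\<Phi> (fps_expansion g 0)) z else 0)
      else 0)"

definition Lm :: "nat \<Rightarrow> complex \<Rightarrow> complex" where
  "Lm m z = - (1 / of_nat m) * Ln (1 - z ^ m)"

definition F_coeff :: "real \<Rightarrow> real \<Rightarrow> complex \<Rightarrow> (complex \<Rightarrow> complex) \<Rightarrow> complex \<Rightarrow> complex" where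
  "F_coeff r1 r2 \<Lambda> =
     scl (L_space r1 r2) \<Lambda> (fps_op r1 r2 (hadamard (fps_expansion (Lm (root_order \<Lambda>)) 0)))"

text \<open>Off the unit circle \<open>F\<close> is given by the explicit formula, on the circle by the series.\<close>

definition F_sol :: "real \<Rightarrow> real \<Rightarrow> complex \<Rightarrow> (complex \<Rightarrow> complex) \<Rightarrow> complex \<Rightarrow> complex" where
  "F_sol r1 r2 q =
     (if cmod q \<noteq> 1
      then fps_op r1 r2
             (\<lambda>A. Abs_fps (\<lambda>n. if n = 0 then 0 else fps_nth A n / (q ^ n - 1)))
      else bwd_sum (L_space r1 r2) (F_coeff r1 r2) q)"


section \<open>The compact sets\<close>

text \<open>For irrational \<open>x\<close> in the unit interval, \<open>x = [0, a\<^sub>1, a\<^sub>2, \<dots>]\<close> with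
  \<open>a\<^sub>k = cf_digit x k\<close> for \<open>k \<ge> 1\<close>.\<close>

definition gauss_map :: "real \<Rightarrow> real" where
  "gauss_map t = frac (1 / t)"

definition cf_digit :: "real \<Rightarrow> nat \<Rightarrow> int" where
  "cf_digit x k = \<lfloor>1 / (gauss_map ^^ (k - 1)) x\<rfloor>"

text \<open>The value of \<open>[0, a\<^sub>1, \<dots>, a\<^sub>k]\<close>.\<close>

fun cf_value :: "int list \<Rightarrow> rat" where
  "cf_value [] = 0"
| "cf_value (a # as) = 1 / (of_int a + cf_value as)"

definition conv_denom :: "real \<Rightarrow> nat \<Rightarrow> nat" where
  "conv_denom x k = nat (snd (quotient_of (cf_value (map (cf_digit x) [1..<Suc k]))))"

text \<open>Subsets of \<open>\<real>/\<int>\<close> and \<open>\<complex>/\<int>\<close> are represented by their full preimages in \<open>\<real>\<close> and \<open>\<complex>\<close>;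
  \<open>frac y\<close> is the representative of the class of \<open>y\<close> in the unit interval.\<close>

definition C_real :: "(nat \<Rightarrow> real) \<Rightarrow> real set" where
  "C_real \<psi> = {y. y \<notin> \<rat> \<and>
     (\<forall>k. real (conv_denom (frac y) (Suc k)) \<le> 1 / \<psi> (conv_denom (frac y) k))}"

definition C_cplx :: "(nat \<Rightarrow> real) \<Rightarrow> real \<Rightarrow> real \<Rightarrow> complex set" where
  "C_cplx \<psi> \<kappa> d = {x. \<exists>y\<in>C_real \<psi>.
     \<kappa> * \<bar>Re (x - of_real y)\<bar> \<le> \<bar>Im x\<bar> \<and> \<bar>Im x\<bar> \<le> d}"

definition K_set :: "real \<Rightarrow> real \<Rightarrow> real \<Rightarrow> (nat \<Rightarrow> real) \<Rightarrow> nat \<Rightarrow> complex set" where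
  "K_set \<kappa> d \<alpha> \<gamma> j =
     (\<lambda>x. exp (2 * of_real pi * \<i> * x)) ` C_cplx (\<lambda>m. \<gamma> j * exp (- \<alpha> * real m)) \<kappa> d"


section \<open>Monogenic functions\<close>

text \<open>Functions are total; membership depends only on their values on the sets in question.\<close>

definition C1_hol :: "complex set \<Rightarrow> 'b::ab_group_add nspace \<Rightarrow> (complex \<Rightarrow> 'b) set" where
  "C1_hol C E = {f. continuous_map (top_of_set C) (ntopology E) f \<and>
     (\<exists>f1. continuous_map (top_of_set C) (ntopology E) f1 \<and>
       (\<forall>z\<in>C. \<forall>\<epsilon>>0. \<exists>\<delta>>0. \<forall>z1\<in>C. \<forall>z2\<in>C.
          cmod (z1 - z) < \<delta> \<and> cmod (z2 - z) < \<delta> \<longrightarrow>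
          nrm E (f z2 - f z1 - scl E (z2 - z1) (f1 z1)) \<le> \<epsilon> * cmod (z1 - z2)))}"

definition monogenic :: "(nat \<Rightarrow> complex set) \<Rightarrow> 'b::ab_group_add nspace \<Rightarrow> (complex \<Rightarrow> 'b) set" where
  "monogenic K E = {f. \<forall>j. f \<in> C1_hol (K j) E}"

end

theory Submission
  imports Defs
begin

text \<open>
  A point \<open>q\<close> of \<open>K\<^sub>j\<close> has distance at least a constant times \<open>e\<^bsup>-\<alpha>m\<^esup> / m\<^sup>2\<close> from every root of unity
  of order \<open>m\<close>, by a Diophantine estimate for the points of \<open>C_real\<close>. The Taylor remainder of
  first order of \<open>1 / (q - \<Lambda>)\<close> is quadratic in the increment with a coefficient bounded by the inverse
  cube of this distance. There are at most \<open>m\<close> roots of order \<open>m\<close>, so for \<open>r < e\<^bsup>-3\<alpha>\<^esup>\<close> the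
  series of these bounds converges and the sum is \<open>C\<^sup>1\<close>-holomorphic on \<open>K\<^sub>j\<close>. For the cohomological
  equation, \<open>\<Lambda> \<mapsto> \<Lambda> L\<^sub>m \<odot>\<close> lies in \<open>S(r\<^sub>2 / r\<^sub>1, L(B\<^bsub>r1\<^esub>, B\<^bsub>r2\<^esub>))\<close> by Cauchy's estimates, and off the unit
  circle the sum is computed coefficientwise from \<open>\<Sum>\<^bsub>\<Lambda>^n=1\<^esub> \<Lambda> / (q - \<Lambda>) = n / (q\<^sup>n - 1)\<close>.
\<close>

section \<open>Continued fractions\<close>

text \<open>\<open>C1_hol\<close> compares arbitrary pairs of nearby points of a compact set, and
  the segment between two such points may leave the set, so a remainder estimate cannot be had by
  integrating a derivative along it. The proof uses exact algebraic identities for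
  \<open>1 / (q - w)\<close> at two points of the set instead; they reduce existence of the sum,
  continuity and differentiability to one summable majorant. The constant 3 counts the pole factors
  in these identities: both an increment of the derivative series and the Taylor remainder contain
  three. Each factor costs m^2 e^(\<alpha> m) up to a constant: the exponential is the size of 1 /
  \<psi>_j(m), the square comes from comparing n / m with convergents. The strict inequality r <
  e^(-3 \<alpha>) leaves a geometric factor that absorbs all powers of m, so crude polynomial bounds
  suffice. On the unit circle F is the series by definition; elsewhere the formula with q^n - 1 has
  to be identified with it before both regions can be treated as one function on K_j.\<close>

lemma irrational_gauss_map:
  assumes "x \<notin> \<rat>"
  shows "gauss_map x \<notin> \<rat>"
proof
  assume "gauss_map x \<in> \<rat>"
  moreover have "1 / x = gauss_map x + of_int \<lfloor>1 / x\<rfloor>"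
    by (simp add: gauss_map_def frac_def)
  ultimately have "1 / x \<in> \<rat>"
    by (metis Rats_add Rats_of_int)
  then have "inverse (1 / x) \<in> \<rat>"
    by (rule Rats_inverse)
  with assms show False
    by simp
qed

lemma gauss_map_bounds:
  assumes "x \<notin> \<rat>"
  shows "0 < gauss_map x" "gauss_map x < 1"
proof -
  have "gauss_map x \<noteq> 0"
    using irrational_gauss_map[OF assms] by auto
  moreover have "0 \<le> gauss_map x"
    by (simp add: gauss_map_def)
  ultimately show "0 < gauss_map x"
    by simp
  show "gauss_map x < 1"
    by (simp add: gauss_map_def frac_lt_1)
qed

text \<open>The recursion peels off the first digit, \<open>x = 1 / (a\<^sub>1 + gauss_map x)\<close>, instead of the last one,
  so that every property of the convergents follows by induction with \<open>x\<close> arbitrary.\<close>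

fun conv_num :: "real \<Rightarrow> nat \<Rightarrow> int" and conv_den :: "real \<Rightarrow> nat \<Rightarrow> int" where
  "conv_num x 0 = 0"
| "conv_num x (Suc k) = conv_den (gauss_map x) k"
| "conv_den x 0 = 1"
| "conv_den x (Suc k) = \<lfloor>1 / x\<rfloor> * conv_den (gauss_map x) k + conv_num (gauss_map x) k"

locale irrational_01 =
  fixes x :: real
  assumes irr: "x \<notin> \<rat>" and pos: "0 < x" and less1: "x < 1"
begin

lemma digit_ge_1: "1 \<le> \<lfloor>1 / x\<rfloor>"
  using pos less1 by (simp add: le_floor_iff)

lemma inverse_expand: "1 / x = of_int \<lfloor>1 / x\<rfloor> + gauss_map x"
  by (simp add: gauss_map_def frac_def)

lemma gauss: "irrational_01 (gauss_map x)"
  by unfold_locales (use gauss_map_bounds[OF irr] irrational_gauss_map[OF irr] in auto)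

end

lemma conv_num_den_nonneg:
  assumes "irrational_01 x"
  shows "0 \<le> conv_num x k \<and> 1 \<le> conv_den x k"
  using assms
proof (induction k arbitrary: x)
  case (Suc k)
  interpret irrational_01 x by fact
  have "1 * 1 \<le> \<lfloor>1 / x\<rfloor> * conv_den (gauss_map x) k"
    by (rule mult_mono) (use digit_ge_1 Suc.IH[OF gauss] in linarith)+
  with Suc.IH[OF gauss] show ?case
    by (simp only: conv_num.simps conv_den.simps) linarith
qed auto

text \<open>One Euclidean step: a common divisor of q and a q + p divides p, so coprimality is
  inherited from the pair of \<open>gauss_map x\<close>.\<close>

lemma coprime_conv:
  "coprime (conv_num x k) (conv_den x k)"
proof (induction k arbitrary: x)
  case (Suc k)
  have "coprime (conv_den (gauss_map x) k)
      (\<lfloor>1 / x\<rfloor> * conv_den (gauss_map x) k + conv_num (gauss_map x) k)"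
    using Suc.IH[of "gauss_map x"]
    by (metis coprime_commute coprime_iff_gcd_eq_1 gcd_add_mult add.commute mult.commute)
  then show ?case
    by simp
qed simp

lemma cf_digits_Suc:
  "map (cf_digit x) [1..<Suc (Suc k)] = \<lfloor>1 / x\<rfloor> # map (cf_digit (gauss_map x)) [1..<Suc k]"
proof -
  \<comment> \<open>Digits are indexed from 1. The truncated subtraction in \<open>cf_digit\<close>
    makes index 0 a copy of index 1, so the shift is claimed only for
    \<open>i \<ge> 1\<close>.\<close>
  have "cf_digit x (Suc i) = cf_digit (gauss_map x) i" if "i \<ge> 1" for i
    using that by (cases i) (simp_all add: cf_digit_def funpow_swap1)
  then have "map (cf_digit x) (map Suc [1..<Suc k]) = map (cf_digit (gauss_map x)) [1..<Suc k]"
    by auto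
  then show ?thesis
    by (subst upt_conv_Cons) (simp_all only: map_Suc_upt list.map, simp_all add: cf_digit_def)
qed

lemma cf_value_conv:
  assumes "irrational_01 x"
  shows "cf_value (map (cf_digit x) [1..<Suc k]) = of_int (conv_num x k) / of_int (conv_den x k)"
  using assms
proof (induction k arbitrary: x)
  case (Suc k)
  interpret irrational_01 x by fact
  have "conv_den (gauss_map x) k \<noteq> 0"
    using conv_num_den_nonneg[OF gauss, of k] by auto
  then have "1 / (of_int \<lfloor>1 / x\<rfloor> + of_int (conv_num (gauss_map x) k) / of_int (conv_den (gauss_map x) k) :: rat)
      = of_int (conv_den (gauss_map x) k) /
        (of_int \<lfloor>1 / x\<rfloor> * of_int (conv_den (gauss_map x) k) + of_int (conv_num (gauss_map x) k))"
    by (simp add: divide_simps)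
  with Suc.IH[OF gauss] show ?case
    unfolding cf_digits_Suc by simp
qed simp

text \<open>\<open>quotient_of\<close> returns the reduced fraction, and the recursive pair is
  already coprime with positive denominator. The condition defining \<open>C_real\<close> thus
  becomes one on \<open>conv_den\<close>.\<close>

lemma conv_denom_eq:
  assumes "irrational_01 x"
  shows "int (conv_denom x k) = conv_den x k"
proof -
  have pos: "conv_den x k > 0"
    using conv_num_den_nonneg[OF assms, of k] by auto
  have "cf_value (map (cf_digit x) [1..<Suc k]) = Fract (conv_num x k) (conv_den x k)"
    unfolding cf_value_conv[OF assms] by (rule Fract_of_int_quotient[symmetric])
  then have "quotient_of (cf_value (map (cf_digit x) [1..<Suc k])) = (conv_num x k, conv_den x k)"
    using pos by (simp add: quotient_of_Fract coprime_conv)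
  then show ?thesis
    using pos unfolding conv_denom_def by simp
qed

text \<open>The pair of \<open>x\<close> arises from that of \<open>gauss_map x\<close> by the
  matrix with rows (0, 1) and (1, a), of determinant -1, so each induction step flips the
  sign.\<close>

lemma conv_det:
  "conv_num x (Suc k) * conv_den x k - conv_num x k * conv_den x (Suc k) = (-1) ^ k"
proof (induction k arbitrary: x)
  case (Suc k)
  show ?case
    using Suc.IH[of "gauss_map x"] unfolding conv_num.simps(2)[of x] conv_den.simps(2)[of x] power_Suc
    by (simp add: algebra_simps del: conv_num.simps conv_den.simps)
qed simp

text \<open>Passing from \<open>gauss_map x\<close> to \<open>x\<close> multiplies the error q x - p
  by -x; hence convergents lie alternately below and above \<open>x\<close>.\<close>

lemma conv_side:
  assumes "irrational_01 x"
  shows "0 < (-1) ^ k * (of_int (conv_den x k) * x - of_int (conv_num x k))"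
  using assms
proof (induction k arbitrary: x)
  case 0
  then show ?case by (simp add: irrational_01_def)
next
  case (Suc k)
  interpret irrational_01 x by fact
  let ?p = "of_int (conv_num (gauss_map x) k) :: real" and ?q = "of_int (conv_den (gauss_map x) k) :: real"
  have "of_int (conv_den x (Suc k)) * x - of_int (conv_num x (Suc k))
      = x * (of_int \<lfloor>1 / x\<rfloor> * ?q + ?p - ?q * (1 / x))"
    using pos by (simp add: algebra_simps)
  also have "\<dots> = - x * (?q * gauss_map x - ?p)"
    by (subst (2) inverse_expand) (simp add: algebra_simps)
  finally show ?case
    using mult_pos_pos[OF pos Suc.IH[OF gauss]] by (simp only: power_Suc) (simp add: algebra_simps)
qed

text \<open>All digits are at least 1. Numerators and denominators are treated together because
  peeling off the first digit mixes them.\<close>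

lemma conv_growth:
  assumes "irrational_01 x"
  shows "conv_num x (Suc k) + conv_num x k \<le> conv_num x (Suc (Suc k)) \<and>
    conv_den x (Suc k) + conv_den x k \<le> conv_den x (Suc (Suc k))"
  using assms
proof (induction k arbitrary: x)
  case 0
  interpret irrational_01 x by fact
  interpret g: irrational_01 "gauss_map x" by (rule gauss)
  have "\<lfloor>1 / x\<rfloor> * 1 \<le> \<lfloor>1 / x\<rfloor> * \<lfloor>1 / gauss_map x\<rfloor>"
    by (rule mult_left_mono) (use digit_ge_1 g.digit_ge_1 in linarith)+
  then show ?case
    using g.digit_ge_1 by simp
next
  case (Suc k)
  interpret irrational_01 x by fact
  note IH = Suc.IH[OF gauss]
  have "\<lfloor>1 / x\<rfloor> * (conv_den (gauss_map x) (Suc k) + conv_den (gauss_map x) k)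
      \<le> \<lfloor>1 / x\<rfloor> * conv_den (gauss_map x) (Suc (Suc k))"
    by (rule mult_left_mono) (use digit_ge_1 IH in linarith)+
  with IH show ?case
    by (simp only: conv_num.simps(2)[of x] conv_den.simps(2)[of x] ring_distribs simp_thms) linarith
qed

text \<open>Consecutive errors have opposite signs, so the determinant identity reads q' |q x - p| +
  q |q' x - p'| = 1; dropping the second term gives the bound.\<close>

lemma conv_error:
  assumes "irrational_01 x"
  shows "\<bar>x - of_int (conv_num x k) / of_int (conv_den x k)\<bar>
    \<le> 1 / (of_int (conv_den x k) * of_int (conv_den x (Suc k)))"
proof -
  define p q p' q' :: real where "p = conv_num x k" and "q = conv_den x k"
    and "p' = conv_num x (Suc k)" and "q' = conv_den x (Suc k)"
  have q: "1 \<le> q" "1 \<le> q'"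
    using conv_num_den_nonneg[OF assms] by (simp_all add: q_def q'_def del: conv_den.simps)
  have "of_int (conv_num x (Suc k) * conv_den x k - conv_num x k * conv_den x (Suc k)) = ((-1) ^ k :: real)"
    unfolding conv_det by simp
  then have det: "p' * q - p * q' = (-1) ^ k"
    by (simp add: p_def q_def p'_def q'_def)
  have s: "0 < (-1) ^ k * (q * x - p)" "0 < (-1) ^ Suc k * (q' * x - p')"
    using conv_side[OF assms] by (simp_all only: p_def q_def p'_def q'_def)
  have "\<bar>q * x - p\<bar> = (-1) ^ k * (q * x - p)"
    using s(1) by (cases "even k") auto
  moreover have "q' * ((-1) ^ k * (q * x - p)) = 1 - q * ((-1) ^ Suc k * (q' * x - p'))"
  proof -
    have "q' * (q * x - p) = q * (q' * x - p') + (p' * q - p * q')"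
      by (simp add: algebra_simps)
    then have "(-1) ^ k * (q' * (q * x - p)) = (-1) ^ k * (q * (q' * x - p')) + (-1) ^ k * (-1) ^ k"
      unfolding det by (simp add: algebra_simps)
    moreover have "(-1) ^ k * (-1) ^ k = (1::real)"
      by (simp flip: power_mult_distrib)
    ultimately show ?thesis
      by (simp add: algebra_simps)
  qed
  moreover have "0 \<le> q * ((-1) ^ Suc k * (q' * x - p'))"
    by (rule mult_nonneg_nonneg) (use s q in linarith)+
  ultimately have "\<bar>q * x - p\<bar> * q' \<le> 1"
    by (simp only: mult.commute)
  moreover have "x - p / q = (q * x - p) / q"
    using q by (simp add: field_simps)
  ultimately show ?thesis
    using q unfolding p_def[symmetric] q_def[symmetric] q'_def[symmetric]
    by (simp add: abs_divide divide_simps mult.commute)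
qed

lemma conv_den_unbounded:
  assumes "irrational_01 x"
  shows "int k \<le> conv_den x k"
proof (induction k)
  case 0
  show ?case by simp
next
  case (Suc k)
  show ?case
  proof (cases k)
    case 0
    then show ?thesis
      using conv_num_den_nonneg[OF assms, of "Suc 0"] by simp
  next
    case (Suc i)
    then have "conv_den x k + conv_den x i \<le> conv_den x (Suc k)"
      using conv_growth[OF assms, of i] by simp
    with Suc.IH conv_num_den_nonneg[OF assms, of i] show ?thesis
      by simp
  qed
qed

text \<open>Compares \<open>n / m\<close> with the convergent following the last one of denominator at most \<open>m\<close>.\<close>

lemma conv_rational_approx:
  assumes x: "irrational_01 x" and m: "0 < (m::nat)"
  obtains k where "conv_den x k \<le> int m"
    "\<And>n::int. 1 / (of_int (conv_den x (Suc k)) * real (m * (m + 1))) \<le> \<bar>x - of_int n / real m\<bar>"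
proof -
  \<comment> \<open>This index satisfies q_k <= m < q_(k+1); if it is 0, the left inequality is q_0
    = 1 <= m.\<close>
  define k where "k = (LEAST k. int m < conv_den x (Suc k))"
  have "int m < conv_den x (Suc m)"
    using conv_den_unbounded[OF x, of "Suc m"] by simp
  then have k: "int m < conv_den x (Suc k)"
    unfolding k_def by (rule LeastI)
  have le: "conv_den x k \<le> int m"
  proof (cases k)
    case (Suc i)
    then have "\<not> int m < conv_den x (Suc i)"
      using not_less_Least[of i "\<lambda>k. int m < conv_den x (Suc k)"] k_def by simp
    with Suc show ?thesis by simp
  qed (use m in simp)
  \<comment> \<open>n / m differs from P / Q by at least 1 / (m Q), while x is within 1 / (Q R) of P
    / Q. Since R >= m + 1, the gap left is 1 / (m Q) - 1 / ((m + 1) Q), which is the claimed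
    bound.\<close>
  define P Q R where "P = conv_num x (Suc k)" and "Q = conv_den x (Suc k)"
    and "R = conv_den x (Suc (Suc k))"
  have QR: "int m < Q" "int m + 1 \<le> R" "0 < real_of_int Q" "0 < real_of_int R"
    using k conv_growth[OF x, of k] conv_num_den_nonneg[OF x, of k]
    by (auto simp: Q_def R_def simp del: conv_den.simps)
  have "1 / (Q * real (m * (m + 1))) \<le> \<bar>x - of_int n / real m\<bar>" for n :: int
  proof -
    \<comment> \<open>Otherwise Q, coprime to P, would divide m although 0 < m < Q.\<close>
    have "n * Q \<noteq> P * int m"
    proof
      assume eq: "n * Q = P * int m"
      have "coprime Q P"
        using coprime_conv[of x "Suc k"] by (simp only: P_def Q_def coprime_commute)
      moreover have "Q dvd P * int m"
        using eq by (metis dvd_triv_right)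
      ultimately have "Q dvd int m"
        by (simp add: coprime_dvd_mult_right_iff)
      then show False
        using zdvd_imp_le[of Q "int m"] QR m by simp
    qed
    then have "1 \<le> \<bar>n * Q - P * int m\<bar>"
      by linarith
    then have "1 \<le> \<bar>of_int n * of_int Q - of_int P * real m\<bar>"
      by (metis of_int_1_le_iff of_int_abs of_int_diff of_int_mult of_int_of_nat_eq)
    moreover have "of_int n / real m - of_int P / of_int Q = (of_int n * of_int Q - of_int P * real m) / (real m * of_int Q)"
      using m QR by (simp add: field_simps)
    ultimately have "1 / (real m * of_int Q) \<le> \<bar>of_int n / real m - of_int P / of_int Q\<bar>"
      using m QR by (simp add: abs_divide abs_mult divide_right_mono)
    moreover have "\<bar>x - of_int P / of_int Q\<bar> \<le> 1 / (of_int Q * of_int R)"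
      using conv_error[OF x, of "Suc k"] by (simp only: P_def Q_def R_def)
    moreover have "1 / (of_int Q * of_int R) \<le> 1 / (of_int Q * (real m + 1))"
    proof -
      have "real_of_int (int m + 1) \<le> of_int R"
        using QR(2) of_int_le_iff by blast
      then show ?thesis
        using QR m by (intro divide_left_mono mult_left_mono) auto
    qed
    moreover have "1 / (real m * of_int Q) - 1 / (of_int Q * (real m + 1)) = 1 / (Q * real (m * (m + 1)))"
    proof -
      have "1 / (a * b) - 1 / (b * (a + 1)) = 1 / (b * (a * (a + 1)))" if "0 < a" "0 < b" for a b :: real
        using that by (simp add: divide_simps)
      from this[of "real m" "of_int Q"] show ?thesis
        using m QR by (simp add: distrib_left)
    qed
    ultimately show ?thesis
      by linarith
  qed
  with le show thesis
    by (intro that[of k]) (auto simp: Q_def simp del: conv_den.simps)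
qed

text \<open>The approximation bound involves only the denominator following q_k. It is at most 1 /
  \<psi>(q_k), and q_k <= m with \<psi> decreasing replaces this by 1 / \<psi>(m). The fraction n /
  m may be reducible, as happens when \<open>\<Lambda> ^ m = 1\<close> with m not the exact
  order.\<close>

lemma C_real_diophantine:
  assumes y: "y \<in> C_real \<psi>" and dec: "decseq \<psi>" and pos: "\<And>m. 0 < \<psi> m" and m: "0 < (m::nat)"
  shows "\<psi> m / real (m * (m + 1)) \<le> \<bar>y - of_int n / real m\<bar>"
proof -
  define x where "x = frac y"
  have irr: "y \<notin> \<rat>" and
    le: "\<And>k. real (conv_denom x (Suc k)) \<le> 1 / \<psi> (conv_denom x k)"
    using y by (auto simp: C_real_def x_def)
  have "x \<notin> \<rat>"
    using irr by (metis x_def Rats_add Rats_of_int frac_def diff_add_cancel)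
  moreover have "0 \<le> x" "x < 1"
    by (auto simp: x_def frac_lt_1)
  ultimately have x: "irrational_01 x"
    by (metis Rats_0 irrational_01_def less_eq_real_def)
  obtain k where k: "conv_den x k \<le> int m" and
    "\<And>n::int. 1 / (of_int (conv_den x (Suc k)) * real (m * (m + 1))) \<le> \<bar>x - of_int n / real m\<bar>"
    using conv_rational_approx[OF x m] by metis
  \<comment> \<open>Subtracting the integer part of \<open>y\<close> from n / m transfers the
    estimate from \<open>frac y\<close> to \<open>y\<close>.\<close>
  note this(2)[of "n - \<lfloor>y\<rfloor> * int m"]
  moreover have "x - of_int (n - \<lfloor>y\<rfloor> * int m) / real m = y - of_int n / real m"
    using m by (simp add: x_def frac_def field_simps)
  moreover have "\<psi> m / real (m * (m + 1)) \<le> 1 / (of_int (conv_den x (Suc k)) * real (m * (m + 1)))"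
  proof -
    have Q: "0 < conv_den x (Suc k)"
      using conv_num_den_nonneg[OF x, of "Suc k"] by simp
    have "conv_denom x k \<le> m"
      using k conv_denom_eq[OF x, of k] by simp
    then have "\<psi> m \<le> \<psi> (conv_denom x k)"
      by (rule decseqD[OF dec])
    also have "of_int (conv_den x (Suc k)) \<le> 1 / \<psi> (conv_denom x k)"
      using le[of k] conv_denom_eq[OF x, of "Suc k"] by (metis of_int_of_nat_eq)
    then have "\<psi> (conv_denom x k) \<le> 1 / of_int (conv_den x (Suc k))"
      using Q pos[of "conv_denom x k"] by (simp add: field_simps del: conv_den.simps)
    finally have "\<psi> m / real (m * (m + 1)) \<le> (1 / of_int (conv_den x (Suc k))) / real (m * (m + 1))"
      by (rule divide_right_mono) simp
    then show ?thesis by simp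
  qed
  ultimately show ?thesis
    by linarith
qed

section \<open>Distance to the roots of unity\<close>

text \<open>If \<open>q\<close> is close to \<open>\<Lambda>\<close>, then \<open>Ln (q / \<Lambda>)\<close> is \<open>2 \<pi> i (x - n / m)\<close> for a logarithm \<open>x\<close> of \<open>q\<close>,
  and the cone condition bounds \<open>\<bar>x - n / m\<bar>\<close> below by the distance of a point of \<open>C_real\<close> to \<open>n / m\<close>.\<close>

lemma K_set_separated:
  assumes "0 < \<kappa>" "0 < \<alpha>" "0 < \<gamma> j"
  obtains c where "0 < c" "c \<le> 1"
    "\<And>q \<Lambda> m. q \<in> K_set \<kappa> d \<alpha> \<gamma> j \<Longrightarrow> 0 < m \<Longrightarrow> \<Lambda> ^ m = 1 \<Longrightarrow>
      c * exp (- \<alpha> * real m) / real m ^ 2 \<le> cmod (q - \<Lambda>)"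
proof -
  define \<psi> where "\<psi> = (\<lambda>m. \<gamma> j * exp (- \<alpha> * real m))"
  \<comment> \<open>The entry 1/2 serves the points with |q / \<Lambda> - 1| >= 1/2; the factor
    \<kappa> / (1 + \<kappa>) is what remains after replacing x by the apex y of its cone, by the
    triangle inequality.\<close>
  define c where "c = min (1/2) (\<kappa> / (1 + \<kappa>) * \<gamma> j)"
  have c: "0 < c" "c \<le> 1/2" "c \<le> \<kappa> / (1 + \<kappa>) * \<gamma> j"
    using assms by (simp add: c_def, simp_all only: c_def min.cobounded1 min.cobounded2)
  have dec: "decseq \<psi>"
    using assms by (auto simp: decseq_def \<psi>_def)
  have bound: "c * exp (- \<alpha> * real m) / real m ^ 2 \<le> cmod (q - \<Lambda>)"
    if q: "q \<in> K_set \<kappa> d \<alpha> \<gamma> j" and m: "0 < m" and \<Lambda>: "\<Lambda> ^ m = 1" for q \<Lambda> m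
  proof -
    have norm_\<Lambda>: "cmod \<Lambda> = 1"
      using \<Lambda> m by (metis gr_implies_not0 norm_one norm_power power_eq_1_iff norm_ge_zero)
    obtain x y where q_eq: "q = exp (2 * of_real pi * \<i> * x)" and y: "y \<in> C_real \<psi>"
      and xy: "\<kappa> * \<bar>Re x - y\<bar> \<le> \<bar>Im x\<bar>"
      using q by (auto simp: K_set_def C_cplx_def \<psi>_def)
    define v where "v = q / \<Lambda> - 1"
    have "q - \<Lambda> = \<Lambda> * v"
      using norm_\<Lambda> by (auto simp: v_def field_simps)
    then have norm_v: "cmod (q - \<Lambda>) = cmod v"
      by (simp add: norm_mult norm_\<Lambda>)
    show ?thesis
    proof (cases "cmod v < 1/2")
      case False
      have "exp (- \<alpha> * real m) \<le> 1"
        using assms by simp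
      moreover have "1 \<le> real m ^ 2"
        using m by (simp add: one_le_power)
      ultimately have "c * exp (- \<alpha> * real m) / real m ^ 2 \<le> (1/2) * 1 / 1"
        using c by (intro frac_le mult_mono) auto
      with False norm_v show ?thesis by linarith
    next
      case True
      define u where "u = Ln (1 + v)"
      have "exp u = q / \<Lambda>"
        unfolding u_def using norm_\<Lambda> q_eq by (subst exp_Ln) (auto simp: v_def)
      \<comment> \<open>Multiplying by m removes \<open>\<Lambda>\<close>, so m u and 2 \<pi> i m x
        are logarithms of the same number. They differ by 2 \<pi> i N, and dividing by m produces
        the rational -N / m.\<close>
      then have "exp (of_nat m * u) = q ^ m"
        by (simp add: exp_of_nat_mult power_divide \<Lambda>)
      also have "\<dots> = exp (of_nat m * (2 * of_real pi * \<i> * x))"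
        by (simp add: q_eq exp_of_nat_mult)
      finally obtain N :: int where
        "of_nat m * u = of_nat m * (2 * of_real pi * \<i> * x) + (of_int (2 * N) * pi) * \<i>"
        unfolding exp_eq by auto
      then have u_eq: "u = 2 * of_real pi * \<i> * (x - of_real (of_int (- N) / real m))"
        using m by (simp add: field_simps)
      define t where "t = of_int (- N) / real m"
      define \<rho> where "\<rho> = cmod (x - of_real t)"
      have "2 * pi * \<rho> = cmod u"
        unfolding u_eq \<rho>_def t_def by (simp add: norm_mult)
      also have "\<dots> \<le> 2 * cmod v"
        unfolding u_def by (rule norm_Ln_le[OF True])
      \<comment> \<open>From \<pi> \<rho> <= |v| and \<pi> >= 2. This factor 2 pays for m (m + 1) <=
        2 m^2 below.\<close>
      finally have \<rho>v: "2 * \<rho> \<le> cmod v"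
        using mult_right_mono[of 2 pi \<rho>] pi_ge_two by (simp add: \<rho>_def)
      have "\<bar>Im x\<bar> \<le> \<rho>" "\<bar>Re x - t\<bar> \<le> \<rho>"
        using abs_Im_le_cmod[of "x - of_real t"] abs_Re_le_cmod[of "x - of_real t"]
        by (auto simp: \<rho>_def)
      moreover from this have "\<kappa> * \<bar>Re x - t\<bar> \<le> \<kappa> * \<rho>"
        using assms by simp
      moreover have "\<kappa> * \<bar>y - t\<bar> \<le> \<kappa> * (\<bar>Re x - y\<bar> + \<bar>Re x - t\<bar>)"
        using assms by (intro mult_left_mono) auto
      ultimately have "\<kappa> * \<bar>y - t\<bar> \<le> (1 + \<kappa>) * \<rho>"
        using xy by (simp add: algebra_simps)
      then have "\<kappa> / (1 + \<kappa>) * \<bar>y - t\<bar> \<le> \<rho>"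
        using assms by (simp add: field_simps)
      moreover have "\<psi> m / real (m * (m + 1)) \<le> \<bar>y - t\<bar>"
        unfolding t_def by (rule C_real_diophantine[OF y dec _ m]) (use assms in \<open>simp add: \<psi>_def\<close>)
      then have "\<kappa> / (1 + \<kappa>) * (\<psi> m / real (m * (m + 1))) \<le> \<kappa> / (1 + \<kappa>) * \<bar>y - t\<bar>"
        using assms by (intro mult_left_mono) auto
      moreover have "c * exp (- \<alpha> * real m) / real m ^ 2 \<le> 2 * (\<kappa> / (1 + \<kappa>) * (\<psi> m / real (m * (m + 1))))"
      proof -
        have "c * exp (- \<alpha> * real m) \<le> \<kappa> / (1 + \<kappa>) * \<psi> m"
          using mult_right_mono[OF c(3), of "exp (- \<alpha> * real m)"] by (simp add: \<psi>_def)
        then have "c * exp (- \<alpha> * real m) / real m ^ 2 \<le> \<kappa> / (1 + \<kappa>) * \<psi> m / real m ^ 2"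
          by (rule divide_right_mono) simp
        also have "real (m * (m + 1)) \<le> 2 * real m ^ 2"
          using m by (simp add: power2_eq_square)
        then have "\<kappa> / (1 + \<kappa>) * \<psi> m / real m ^ 2 \<le> \<kappa> / (1 + \<kappa>) * \<psi> m / (real (m * (m + 1)) / 2)"
          using assms m by (intro divide_left_mono) (auto simp: \<psi>_def intro!: mult_pos_pos add_pos_pos)
        finally show ?thesis
          by (simp add: mult_ac)
      qed
      ultimately show ?thesis
        using \<rho>v norm_v by linarith
    qed
  qed
  show thesis
    by (rule that[of c]) (use c bound in auto)
qed

section \<open>Series in normed spaces given by carriers\<close>

locale complex_normed_space =
  fixes E :: "'b::ab_group_add nspace"
  assumes complex_normed: "complex_normed E"
begin

lemma vector_space: "vector_space (scl E)" and subspace: "module.subspace (scl E) (vecs E)"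
  using complex_normed by (auto simp: complex_normed_def)

lemma module_scl: "module (scl E)"
  using vector_space by (simp add: module_iff_vector_space)

lemmas scl_left_diff = module.scale_left_diff_distrib[OF module_scl]
  and scl_right_diff = module.scale_right_diff_distrib[OF module_scl]
  and scl_scl = module.scale_scale[OF module_scl]
  and scl_sum_right = module.scale_sum_right[OF module_scl]

lemma vecs_zero [simp]: "0 \<in> vecs E"
  by (rule module.subspace_0[OF module_scl subspace])

lemma vecs_add [simp, intro]: "x \<in> vecs E \<Longrightarrow> y \<in> vecs E \<Longrightarrow> x + y \<in> vecs E"
  by (rule module.subspace_add[OF module_scl subspace])

lemma vecs_diff [simp, intro]: "x \<in> vecs E \<Longrightarrow> y \<in> vecs E \<Longrightarrow> x - y \<in> vecs E"
  by (rule module.subspace_diff[OF module_scl subspace])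

lemma vecs_scl [simp, intro]: "x \<in> vecs E \<Longrightarrow> scl E c x \<in> vecs E"
  by (rule module.subspace_scale[OF module_scl subspace])

lemma vecs_sum [intro]: "(\<And>i. i \<in> X \<Longrightarrow> b i \<in> vecs E) \<Longrightarrow> sum b X \<in> vecs E"
  by (rule module.subspace_sum[OF module_scl subspace])

lemma nrm_nonneg: "x \<in> vecs E \<Longrightarrow> 0 \<le> nrm E x"
  and nrm_eq_0_iff: "x \<in> vecs E \<Longrightarrow> nrm E x = 0 \<longleftrightarrow> x = 0"
  and nrm_triangle: "x \<in> vecs E \<Longrightarrow> y \<in> vecs E \<Longrightarrow> nrm E (x + y) \<le> nrm E x + nrm E y"
  and nrm_scl: "x \<in> vecs E \<Longrightarrow> nrm E (scl E c x) = cmod c * nrm E x"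
  using complex_normed by (auto simp: complex_normed_def)

lemma nrm_zero [simp]: "nrm E 0 = 0"
  using nrm_eq_0_iff[of 0] by simp

lemma nrm_minus: "x \<in> vecs E \<Longrightarrow> nrm E (- x) = nrm E x"
  using nrm_scl[of x "-1"] module.scale_minus_left[OF module_scl, of 1 x]
    module.scale_one[OF module_scl, of x] by simp

lemma nrm_diff_commute: "x \<in> vecs E \<Longrightarrow> y \<in> vecs E \<Longrightarrow> nrm E (x - y) = nrm E (y - x)"
  using nrm_minus[of "x - y"] by auto

lemma nrm_triangle_diff:
  "x \<in> vecs E \<Longrightarrow> y \<in> vecs E \<Longrightarrow> z \<in> vecs E \<Longrightarrow> nrm E (x - z) \<le> nrm E (x - y) + nrm E (y - z)"
  using nrm_triangle[of "x - y" "y - z"] by auto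

lemma nrm_sum_le:
  "(\<And>i. i \<in> X \<Longrightarrow> b i \<in> vecs E) \<Longrightarrow> nrm E (sum b X) \<le> (\<Sum>i\<in>X. nrm E (b i))"
proof (induction X rule: infinite_finite_induct)
  case (insert i X)
  then have "nrm E (b i + sum b X) \<le> nrm E (b i) + nrm E (sum b X)"
    by (intro nrm_triangle) auto
  with insert show ?case by auto
qed auto

sublocale Metric_space "vecs E" "ndist E"
proof
  show "0 \<le> ndist E x y" for x y
    by (auto simp: ndist_def intro: nrm_nonneg)
  show "ndist E x y = ndist E y x" for x y
    by (simp add: ndist_def nrm_diff_commute)
  show "ndist E x y = 0 \<longleftrightarrow> x = y" if "x \<in> vecs E" "y \<in> vecs E" for x y
    using that nrm_eq_0_iff[of "x - y"] by (auto simp: ndist_def)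
  show "ndist E x z \<le> ndist E x y + ndist E y z" if "x \<in> vecs E" "y \<in> vecs E" "z \<in> vecs E" for x y z
    using that nrm_triangle_diff by (simp add: ndist_def)
qed

text \<open>Convergence along finite subsets written with the norm alone, so that limits follow from
  real-valued estimates instead of the topology of \<open>ndist\<close>.\<close>

definition has_nsum :: "('i \<Rightarrow> 'b) \<Rightarrow> 'i set \<Rightarrow> 'b \<Rightarrow> bool" where
  "has_nsum b R s \<longleftrightarrow>
     s \<in> vecs E \<and> ((\<lambda>X. nrm E (sum b X - s)) \<longlongrightarrow> 0) (finite_subsets_at_top R)"

lemma limitin_has_nsum:
  assumes "\<And>i. i \<in> R \<Longrightarrow> b i \<in> vecs E"
  shows "limitin (ntopology E) (sum b) s (finite_subsets_at_top R) \<longleftrightarrow> has_nsum b R s"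
proof -
  \<comment> \<open>\<open>ndist\<close> agrees with the norm of the difference only inside the
    carrier, so the partial sums are first placed there.\<close>
  have vecs: "\<forall>\<^sub>F X in finite_subsets_at_top R. sum b X \<in> vecs E"
    by (rule eventually_finite_subsets_at_top_weakI) (use assms in auto)
  show ?thesis
  proof (cases "s \<in> vecs E")
    case True
    then have "\<forall>\<^sub>F X in finite_subsets_at_top R. ndist E (sum b X) s = nrm E (sum b X - s)"
      using vecs by (auto elim!: eventually_mono simp: ndist_def)
    then have "((\<lambda>X. ndist E (sum b X) s) \<longlongrightarrow> 0) (finite_subsets_at_top R) \<longleftrightarrow>
        ((\<lambda>X. nrm E (sum b X - s)) \<longlongrightarrow> 0) (finite_subsets_at_top R)"
      by (rule tendsto_cong)
    with True vecs show ?thesis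
      by (simp add: limitin_metric_dist_null has_nsum_def)
  qed (simp add: limitin_metric_dist_null has_nsum_def)
qed

lemma has_nsum_unique:
  assumes "\<And>i. i \<in> R \<Longrightarrow> b i \<in> vecs E" "has_nsum b R s" "has_nsum b R t"
  shows "s = t"
  using assms limitin_metric_unique[of "sum b" s "finite_subsets_at_top R" t]
  by (simp add: limitin_has_nsum)

text \<open>Completeness speaks of sequences, the sum of a net. A sequence of finite sets
  \<open>Y n\<close> whose norm sums come within 1 / (n + 1) of the total bridges the two: enlarging
  \<open>Y n\<close> to any finite set moves the partial sum by no more than this tail.\<close>

lemma has_nsum_exists:
  assumes "complex_banach E" and b: "\<And>i. i \<in> R \<Longrightarrow> b i \<in> vecs E"
    and sm: "(\<lambda>i. nrm E (b i)) summable_on R"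
  shows "\<exists>s. has_nsum b R s"
proof -
  define g where "g = (\<lambda>i. nrm E (b i))"
  define G where "G = infsum g R"
  have g0: "0 \<le> g i" if "i \<in> R" for i
    using b[OF that] nrm_nonneg by (simp add: g_def)
  have gG: "sum g X \<le> G" if "finite X" "X \<subseteq> R" for X
    unfolding G_def by (rule finite_sum_le_infsum) (use sm g0 that in \<open>auto simp: g_def\<close>)
  have bv: "sum b X \<in> vecs E" if "X \<subseteq> R" for X
    using b that by blast
  have close: "nrm E (sum b X - sum b Y) \<le> G - sum g Y"
    if "finite X" "Y \<subseteq> X" "X \<subseteq> R" for X Y
  proof -
    have "sum b X - sum b Y = sum b (X - Y)"
      using that by (simp add: sum_diff)
    then have "nrm E (sum b X - sum b Y) \<le> sum g (X - Y)"
      unfolding g_def using nrm_sum_le[of "X - Y" b] that b by auto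
    also have "\<dots> = sum g X - sum g Y"
      using that by (simp add: sum_diff)
    finally show ?thesis using gG[OF that(1,3)] by simp
  qed
  have "\<exists>Y. finite Y \<and> Y \<subseteq> R \<and> G - sum g Y < 1 / real (Suc n)" for n
  proof -
    have "(sum g \<longlongrightarrow> G) (finite_subsets_at_top R)"
      using sm unfolding g_def G_def by (metis has_sum_def has_sum_infsum)
    then have "\<forall>\<^sub>F X in finite_subsets_at_top R. G - 1 / real (Suc n) < sum g X"
      by (rule order_tendstoD) simp
    then show ?thesis
      unfolding eventually_finite_subsets_at_top by (auto simp: algebra_simps)
  qed
  then obtain Y where Y: "\<And>n. finite (Y n)" "\<And>n. Y n \<subseteq> R" "\<And>n. G - sum g (Y n) < 1 / real (Suc n)"
    by metis
  define \<sigma> where "\<sigma> n = sum b (Y n)" for n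
  have \<sigma>v: "\<sigma> n \<in> vecs E" for n
    using bv Y by (simp add: \<sigma>_def)
  have "MCauchy \<sigma>"
    unfolding MCauchy_def
  proof (intro conjI allI impI)
    show "range \<sigma> \<subseteq> vecs E" using \<sigma>v by auto
    fix \<epsilon> :: real assume "0 < \<epsilon>"
    then obtain N where N: "1 / real (Suc N) < \<epsilon> / 2"
      using nat_approx_posE[of "\<epsilon> / 2"] by auto
    have "ndist E (\<sigma> n) (\<sigma> k) < \<epsilon>" if "N \<le> n" "N \<le> k" for n k
    proof -
      \<comment> \<open>The sets \<open>Y n\<close> need not be nested, so both partial sums are
        compared with the one over the union.\<close>
      define t where "t = sum b (Y n \<union> Y k)"
      have t: "t \<in> vecs E"
        unfolding t_def by (rule bv) (use Y in auto)
      have *: "nrm E (t - \<sigma> i) < \<epsilon> / 2" if "i = n \<or> i = k" for i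
      proof -
        have "nrm E (t - \<sigma> i) \<le> G - sum g (Y i)"
          unfolding \<sigma>_def t_def by (rule close) (use Y that in auto)
        also have "\<dots> < 1 / real (Suc i)" by (rule Y)
        also have "\<dots> \<le> 1 / real (Suc N)"
          using that \<open>N \<le> n\<close> \<open>N \<le> k\<close> by (intro divide_left_mono) auto
        finally show ?thesis
          using N by linarith
      qed
      have "nrm E (\<sigma> n - \<sigma> k) \<le> nrm E (\<sigma> n - t) + nrm E (t - \<sigma> k)"
        using \<sigma>v t by (intro nrm_triangle_diff)
      also have "nrm E (\<sigma> n - t) = nrm E (t - \<sigma> n)"
        using \<sigma>v t by (rule nrm_diff_commute)
      finally have "nrm E (\<sigma> n - \<sigma> k) < \<epsilon>"
        using *[of n] *[of k] by simp
      then show ?thesis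
        using \<sigma>v by (simp add: ndist_def)
    qed
    then show "\<exists>N. \<forall>n n'. N \<le> n \<longrightarrow> N \<le> n' \<longrightarrow> ndist E (\<sigma> n) (\<sigma> n') < \<epsilon>"
      by blast
  qed
  moreover have "mcomplete"
    using assms(1) by (simp add: complex_banach_def)
  ultimately obtain s where "limitin mtopology \<sigma> s sequentially"
    by (auto simp: mcomplete_def)
  then have s: "s \<in> vecs E" and lim: "(\<lambda>n. ndist E (\<sigma> n) s) \<longlonglongrightarrow> 0"
    by (auto simp: limitin_metric_dist_null)
  have "((\<lambda>X. nrm E (sum b X - s)) \<longlongrightarrow> 0) (finite_subsets_at_top R)"
  proof (rule tendstoI)
    fix \<epsilon> :: real assume e: "0 < \<epsilon>"
    have ev1: "\<forall>\<^sub>F n in sequentially. ndist E (\<sigma> n) s < \<epsilon> / 2"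
      using order_tendstoD(2)[OF lim, of "\<epsilon> / 2"] e by simp
    have ev2: "\<forall>\<^sub>F n in sequentially. 1 / real (Suc n) < \<epsilon> / 2"
      using order_tendstoD(2)[OF LIMSEQ_inverse_real_of_nat, of "\<epsilon> / 2"] e by (simp add: inverse_eq_divide)
    obtain n where n: "ndist E (\<sigma> n) s < \<epsilon> / 2" "1 / real (Suc n) < \<epsilon> / 2"
      using eventually_happens'[OF sequentially_bot eventually_conj[OF ev1 ev2]] by (elim exE conjE)
    have "dist (nrm E (sum b X - s)) 0 < \<epsilon>" if X: "finite X" "Y n \<subseteq> X" "X \<subseteq> R" for X
    proof -
      have "nrm E (sum b X - s) \<le> nrm E (sum b X - \<sigma> n) + nrm E (\<sigma> n - s)"
        using bv[OF X(3)] \<sigma>v s by (rule nrm_triangle_diff)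
      also have "nrm E (sum b X - \<sigma> n) < \<epsilon> / 2"
        using close[OF X(1,2,3)] Y(3)[of n] n(2) unfolding \<sigma>_def by linarith
      also have "nrm E (\<sigma> n - s) < \<epsilon> / 2"
        using n \<sigma>v s by (simp add: ndist_def)
      finally show ?thesis
        using nrm_nonneg[OF vecs_diff[OF bv[OF X(3)] s]] by simp
    qed
    then show "\<forall>\<^sub>F X in finite_subsets_at_top R. dist (nrm E (sum b X - s)) 0 < \<epsilon>"
      unfolding eventually_finite_subsets_at_top using Y(1,2)[of n] by (intro exI[of _ "Y n"]) simp
  qed
  with s show ?thesis by (auto simp: has_nsum_def)
qed

lemma has_nsum_diff:
  assumes b: "\<And>i. i \<in> R \<Longrightarrow> b i \<in> vecs E" "\<And>i. i \<in> R \<Longrightarrow> c i \<in> vecs E"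
    and s: "has_nsum b R s" "has_nsum c R t"
  shows "has_nsum (\<lambda>i. b i - c i) R (s - t)"
proof -
  have st: "s \<in> vecs E" "t \<in> vecs E"
    and lim: "((\<lambda>X. nrm E (sum b X - s) + nrm E (sum c X - t)) \<longlongrightarrow> 0) (finite_subsets_at_top R)"
    using s by (auto simp: has_nsum_def intro: tendsto_add_zero)
  have "((\<lambda>X. nrm E ((\<Sum>i\<in>X. b i - c i) - (s - t))) \<longlongrightarrow> 0) (finite_subsets_at_top R)"
  proof (rule tendsto_sandwich[OF _ _ tendsto_const lim])
    have *: "0 \<le> nrm E ((\<Sum>i\<in>X. b i - c i) - (s - t)) \<and>
        nrm E ((\<Sum>i\<in>X. b i - c i) - (s - t)) \<le> nrm E (sum b X - s) + nrm E (sum c X - t)"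
      if "X \<subseteq> R" for X
    proof -
      have v: "sum b X - s \<in> vecs E" "sum c X - t \<in> vecs E"
        using b st that by (auto intro!: vecs_diff)
      have "(\<Sum>i\<in>X. b i - c i) - (s - t) = (sum b X - s) - (sum c X - t)"
        by (simp add: sum_subtractf)
      moreover have "nrm E ((sum b X - s) - (sum c X - t)) \<le> nrm E (sum b X - s) + nrm E (sum c X - t)"
        using nrm_triangle_diff[OF v(1) vecs_zero v(2)] nrm_minus[OF v(2)] by simp
      ultimately show ?thesis
        using nrm_nonneg[OF vecs_diff[OF v]] by (simp only: simp_thms)
    qed
    show "\<forall>\<^sub>F X in finite_subsets_at_top R. 0 \<le> nrm E ((\<Sum>i\<in>X. b i - c i) - (s - t))"
      "\<forall>\<^sub>F X in finite_subsets_at_top R.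
        nrm E ((\<Sum>i\<in>X. b i - c i) - (s - t)) \<le> nrm E (sum b X - s) + nrm E (sum c X - t)"
      by (rule eventually_finite_subsets_at_top_weakI, use * in blast)+
  qed
  with st show ?thesis
    by (auto simp: has_nsum_def)
qed

lemma has_nsum_scl:
  assumes b: "\<And>i. i \<in> R \<Longrightarrow> b i \<in> vecs E" and s: "has_nsum b R s"
  shows "has_nsum (\<lambda>i. scl E c (b i)) R (scl E c s)"
proof -
  have sv: "s \<in> vecs E"
    and lim: "((\<lambda>X. cmod c * nrm E (sum b X - s)) \<longlongrightarrow> 0) (finite_subsets_at_top R)"
    using s by (auto simp: has_nsum_def intro: tendsto_mult_right_zero)
  have "nrm E ((\<Sum>i\<in>X. scl E c (b i)) - scl E c s) = cmod c * nrm E (sum b X - s)" if "X \<subseteq> R" for X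
  proof -
    have "(\<Sum>i\<in>X. scl E c (b i)) - scl E c s = scl E c (sum b X - s)"
      by (simp add: scl_sum_right scl_right_diff)
    moreover have "sum b X - s \<in> vecs E"
      using b sv that by (auto intro!: vecs_diff)
    ultimately show ?thesis by (simp add: nrm_scl)
  qed
  then have "\<forall>\<^sub>F X in finite_subsets_at_top R.
      cmod c * nrm E (sum b X - s) = nrm E ((\<Sum>i\<in>X. scl E c (b i)) - scl E c s)"
    by (intro eventually_finite_subsets_at_top_weakI) simp
  with lim sv show ?thesis
    by (auto simp: has_nsum_def elim: Lim_transform_eventually)
qed

lemma nrm_has_nsum_le:
  assumes b: "\<And>i. i \<in> R \<Longrightarrow> b i \<in> vecs E" and s: "has_nsum b R s"
    and g: "\<And>i. i \<in> R \<Longrightarrow> nrm E (b i) \<le> g i" "g summable_on R"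
  shows "nrm E s \<le> infsum g R"
proof -
  have sv: "s \<in> vecs E" and "((\<lambda>X. nrm E (sum b X - s)) \<longlongrightarrow> 0) (finite_subsets_at_top R)"
    using s by (auto simp: has_nsum_def)
  note lim = tendsto_add[OF tendsto_const this(2), of "infsum g R"]
  have "nrm E s \<le> infsum g R + nrm E (sum b X - s)" if X: "finite X" "X \<subseteq> R" for X
  proof -
    have bX: "sum b X \<in> vecs E" using b X by auto
    have "nrm E s \<le> nrm E (s - sum b X) + nrm E (sum b X)"
      using nrm_triangle_diff[OF sv bX vecs_zero] by simp
    also have "nrm E (sum b X) \<le> sum g X"
      using nrm_sum_le[of X b] sum_mono[of X "\<lambda>i. nrm E (b i)" g] b g X by force
    also have "\<dots> \<le> infsum g R"
    proof (rule finite_sum_le_infsum)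
      show "0 \<le> g i" if "i \<in> R - X" for i
        using that b g nrm_nonneg[of "b i"] by force
    qed (use g X in auto)
    finally show ?thesis
      using nrm_diff_commute[OF sv bX] by simp
  qed
  then show ?thesis
    using tendsto_lowerbound[OF lim eventually_finite_subsets_at_top_weakI] by simp
qed

section \<open>Lipschitz criteria and the series of simple poles\<close>

lemma continuous_map_lipschitz:
  assumes f: "\<And>q. q \<in> C \<Longrightarrow> f q \<in> vecs E"
    and L: "\<And>p q. p \<in> C \<Longrightarrow> q \<in> C \<Longrightarrow> nrm E (f p - f q) \<le> L * cmod (p - q)"
  shows "continuous_map (top_of_set C) mtopology f"
  unfolding continuous_map_to_metric
proof (intro ballI allI impI)
  fix q \<epsilon> assume "q \<in> topspace (top_of_set C)" "0 < (\<epsilon>::real)"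
  then have q: "q \<in> C" by simp
  define \<delta> where "\<delta> = \<epsilon> / (\<bar>L\<bar> + 1)"
  have \<delta>: "0 < \<delta>" using \<open>0 < \<epsilon>\<close> by (simp add: \<delta>_def)
  have "f p \<in> mball (f q) \<epsilon>" if "p \<in> C \<inter> ball q \<delta>" for p
  proof -
    have "nrm E (f q - f p) \<le> L * cmod (q - p)" using that L q by auto
    also have "\<dots> \<le> (\<bar>L\<bar> + 1) * cmod (q - p)" by (intro mult_right_mono) auto
    also have "\<dots> < (\<bar>L\<bar> + 1) * \<delta>"
      using that by (intro mult_strict_left_mono) (auto simp: dist_norm)
    also have "\<dots> = \<epsilon>" by (simp add: \<delta>_def)
    finally show ?thesis
      using f q that by (simp add: in_mball ndist_def)
  qed
  moreover have "openin (top_of_set C) (C \<inter> ball q \<delta>)"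
    by (simp add: openin_open_Int)
  ultimately show "\<exists>U. openin (top_of_set C) U \<and> q \<in> U \<and> (\<forall>p\<in>U. f p \<in> mball (f q) \<epsilon>)"
    using q \<delta> by (intro exI[of _ "C \<inter> ball q \<delta>"]) auto
qed

text \<open>A remainder bound quadratic in the increment and uniform over all pairs in
  \<open>C\<close> leaves a factor |z2 - z1| that can be made small, which gives the locally uniform
  condition of \<open>C1_hol\<close> directly.\<close>

lemma C1_holI_lipschitz:
  assumes f: "\<And>q. q \<in> C \<Longrightarrow> f q \<in> vecs E" and f1: "\<And>q. q \<in> C \<Longrightarrow> f1 q \<in> vecs E"
    and L: "\<And>p q. p \<in> C \<Longrightarrow> q \<in> C \<Longrightarrow> nrm E (f p - f q) \<le> L * cmod (p - q)"
    and L1: "\<And>p q. p \<in> C \<Longrightarrow> q \<in> C \<Longrightarrow> nrm E (f1 p - f1 q) \<le> L1 * cmod (p - q)"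
    and L2: "\<And>p q. p \<in> C \<Longrightarrow> q \<in> C \<Longrightarrow>
      nrm E (f q - f p - scl E (q - p) (f1 p)) \<le> M * cmod (q - p) ^ 2"
  shows "f \<in> C1_hol C E"
proof -
  have "\<exists>\<delta>>0. \<forall>z1\<in>C. \<forall>z2\<in>C. cmod (z1 - z) < \<delta> \<and> cmod (z2 - z) < \<delta> \<longrightarrow>
      nrm E (f z2 - f z1 - scl E (z2 - z1) (f1 z1)) \<le> \<epsilon> * cmod (z1 - z2)"
    if "0 < \<epsilon>" for z and \<epsilon> :: real
  \<comment> \<open>Two points this close to \<open>z\<close> are within \<epsilon> / (|M| + 1) of
    each other; the summand 1 keeps the quotient meaningful for M = 0.\<close>
  proof (intro exI[of _ "\<epsilon> / (2 * (\<bar>M\<bar> + 1))"] conjI ballI impI)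
    show "0 < \<epsilon> / (2 * (\<bar>M\<bar> + 1))" using that by simp
    fix z1 z2 assume z: "z1 \<in> C" "z2 \<in> C"
      "cmod (z1 - z) < \<epsilon> / (2 * (\<bar>M\<bar> + 1)) \<and> cmod (z2 - z) < \<epsilon> / (2 * (\<bar>M\<bar> + 1))"
    have "cmod (z2 - z1) \<le> cmod (z2 - z) + cmod (z1 - z)"
      using norm_triangle_ineq4[of "z2 - z" "z1 - z"] by simp
    also have "\<dots> \<le> \<epsilon> / (\<bar>M\<bar> + 1)"
      using z(3) by (simp add: field_simps)
    finally have "(\<bar>M\<bar> + 1) * cmod (z2 - z1) \<le> \<epsilon>"
      by (simp add: field_simps)
    then have *: "(\<bar>M\<bar> + 1) * cmod (z2 - z1) * cmod (z2 - z1) \<le> \<epsilon> * cmod (z2 - z1)"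
      by (rule mult_right_mono) simp
    have "nrm E (f z2 - f z1 - scl E (z2 - z1) (f1 z1)) \<le> M * cmod (z2 - z1) ^ 2"
      using z by (intro L2)
    also have "\<dots> \<le> (\<bar>M\<bar> + 1) * cmod (z2 - z1) ^ 2"
      by (intro mult_right_mono) auto
    finally show "nrm E (f z2 - f z1 - scl E (z2 - z1) (f1 z1)) \<le> \<epsilon> * cmod (z1 - z2)"
      using * by (simp add: power2_eq_square mult.assoc norm_minus_commute)
  qed
  moreover have "continuous_map (top_of_set C) mtopology f"
    using f L by (rule continuous_map_lipschitz)
  moreover have "continuous_map (top_of_set C) mtopology f1"
    using f1 L1 by (rule continuous_map_lipschitz)
  ultimately show ?thesis
    unfolding C1_hol_def by blast
qed

text \<open>Everything is a sum of \<open>scl E (\<phi> w) (a w)\<close> with a scalar multiplier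
  \<phi> rational in w: the value, the derivative, their increments and the remainder. A bound
  |\<phi> w| <= t / \<delta>(w)^3 gives norm at most t M, so only scalar inequalities remain, with
  the increments carried by t.\<close>

lemma simple_pole_series_C1_hol:
  fixes a :: "complex \<Rightarrow> 'b" and \<delta> :: "complex \<Rightarrow> real"
  assumes banach: "complex_banach E" and a: "\<And>w. w \<in> R \<Longrightarrow> a w \<in> vecs E"
    and \<delta>: "\<And>w. w \<in> R \<Longrightarrow> 0 < \<delta> w" "\<And>w. w \<in> R \<Longrightarrow> \<delta> w \<le> 1"
    and sep: "\<And>q w. q \<in> C \<Longrightarrow> w \<in> R \<Longrightarrow> \<delta> w \<le> cmod (q - w)"
    and sm: "(\<lambda>w. nrm E (a w) / \<delta> w ^ 3) summable_on R"
  shows "\<And>q. q \<in> C \<Longrightarrow> \<exists>s. has_nsum (\<lambda>w. scl E (1 / (q - w)) (a w)) R s"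
    and "(\<And>q. q \<in> C \<Longrightarrow> has_nsum (\<lambda>w. scl E (1 / (q - w)) (a w)) R (f q)) \<Longrightarrow> f \<in> C1_hol C E"
proof -
  define M where "M = (\<Sum>\<^sub>\<infinity>w\<in>R. nrm E (a w) / \<delta> w ^ 3)"
  have scl_le: "nrm E (scl E (\<phi> w) (a w)) \<le> t * (nrm E (a w) / \<delta> w ^ 3)"
    if "w \<in> R" "cmod (\<phi> w) \<le> t / \<delta> w ^ 3" for \<phi> t w
    using that mult_right_mono[OF that(2), of "nrm E (a w)"] a nrm_nonneg by (simp add: nrm_scl)
  have ex: "\<exists>s. has_nsum (\<lambda>w. scl E (\<phi> w) (a w)) R s"
    if "\<And>w. w \<in> R \<Longrightarrow> cmod (\<phi> w) \<le> 1 / \<delta> w ^ 3" for \<phi>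
  proof (rule has_nsum_exists[OF banach])
    show "(\<lambda>w. nrm E (scl E (\<phi> w) (a w))) summable_on R"
      by (rule summable_on_comparison_test[OF sm]) (use scl_le[of _ \<phi> 1] that a nrm_nonneg in auto)
  qed (use a in auto)
  have norm_le: "nrm E s \<le> t * M"
    if "has_nsum (\<lambda>w. scl E (\<phi> w) (a w)) R s" "\<And>w. w \<in> R \<Longrightarrow> cmod (\<phi> w) \<le> t / \<delta> w ^ 3" for \<phi> s t
  proof -
    have "nrm E s \<le> (\<Sum>\<^sub>\<infinity>w\<in>R. t * (nrm E (a w) / \<delta> w ^ 3))"
      by (rule nrm_has_nsum_le[OF _ that(1)]) (use a scl_le that(2) summable_on_cmult_right[OF sm, of t] in auto)
    then show ?thesis
      by (simp only: M_def infsum_cmult_right')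
  qed
  have inv_le: "cmod (1 / (q - w)) \<le> 1 / \<delta> w" if "q \<in> C" "w \<in> R" for q w
    using sep[OF that] \<delta>[OF that(2)] by (auto simp: norm_divide intro!: divide_left_mono mult_pos_pos)
  \<comment> \<open>As \<delta> <= 1, poles of order one and two are also controlled by the cubic
    majorant.\<close>
  have pow_le: "1 / \<delta> w ^ k \<le> 1 / \<delta> w ^ 3" if "w \<in> R" "k \<le> 3" for w k
    using \<delta>[OF that(1)] that(2) by (intro divide_left_mono power_decreasing) auto
  have ne: "q - w \<noteq> 0" if "q \<in> C" "w \<in> R" for q w
    using sep[OF that] \<delta>[OF that(2)] by auto
  show "\<exists>s. has_nsum (\<lambda>w. scl E (1 / (q - w)) (a w)) R s" if "q \<in> C" for q
    by (rule ex) (use inv_le that pow_le[of _ 1] in force)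
  have "\<exists>s. has_nsum (\<lambda>w. scl E (- ((1 / (q - w)) ^ 2)) (a w)) R s" if "q \<in> C" for q
  proof (rule ex)
    fix w assume "w \<in> R"
    then have "cmod (- ((1 / (q - w)) ^ 2)) \<le> (1 / \<delta> w) ^ 2"
      unfolding norm_minus_cancel norm_power using inv_le that by (intro power_mono) auto
    then show "cmod (- ((1 / (q - w)) ^ 2)) \<le> 1 / \<delta> w ^ 3"
      using pow_le[OF \<open>w \<in> R\<close>, of 2] by (simp add: power_divide)
  qed
  \<comment> \<open>The candidate derivative is the series differentiated term by term.\<close>
  then obtain f1 where f1: "\<And>q. q \<in> C \<Longrightarrow> has_nsum (\<lambda>w. scl E (- ((1 / (q - w)) ^ 2)) (a w)) R (f1 q)"
    by metis
  assume f: "\<And>q. q \<in> C \<Longrightarrow> has_nsum (\<lambda>w. scl E (1 / (q - w)) (a w)) R (f q)"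
  have diff: "has_nsum (\<lambda>w. scl E (\<phi> w - \<eta> w) (a w)) R (s - t)"
    if "has_nsum (\<lambda>w. scl E (\<phi> w) (a w)) R s" "has_nsum (\<lambda>w. scl E (\<eta> w) (a w)) R t" for \<phi> \<eta> s t
    using has_nsum_diff[OF _ _ that] a by (auto simp: scl_left_diff)
  have dinv: "1 / (p - w) - 1 / (q - w) = (q - p) * (1 / (p - w)) * (1 / (q - w))"
    if "p \<in> C" "q \<in> C" "w \<in> R" for p q w
    using ne[OF that(1,3)] ne[OF that(2,3)] by (simp add: field_simps)
  have inv2_le: "cmod ((1 / (p - w)) * (1 / (q - w))) \<le> 1 / \<delta> w ^ 2"
    if "p \<in> C" "q \<in> C" "w \<in> R" for p q w
  proof -
    have "cmod (1 / (p - w)) * cmod (1 / (q - w)) \<le> (1 / \<delta> w) * (1 / \<delta> w)"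
      using inv_le that \<delta>[OF that(3)] by (intro mult_mono) auto
    then show ?thesis
      unfolding norm_mult power2_eq_square by simp
  qed
  show "f \<in> C1_hol C E"
  proof (rule C1_holI_lipschitz)
    show "f q \<in> vecs E" "f1 q \<in> vecs E" if "q \<in> C" for q
      using f[OF that] f1[OF that] by (auto simp: has_nsum_def)
    fix p q assume pq: "p \<in> C" "q \<in> C"
    show "nrm E (f p - f q) \<le> M * cmod (p - q)"
    proof (subst mult.commute, rule norm_le[OF diff[OF f[OF pq(1)] f[OF pq(2)]]])
      fix w assume w: "w \<in> R"
      have "cmod (1 / (p - w) - 1 / (q - w)) \<le> cmod (p - q) * (1 / \<delta> w ^ 2)"
        unfolding dinv[OF pq w] mult.assoc norm_mult[of "q - p"] norm_minus_commute[of q p]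
        using inv2_le[OF pq w] by (rule mult_left_mono) simp
      also have "\<dots> \<le> cmod (p - q) * (1 / \<delta> w ^ 3)"
        using pow_le[OF w, of 2] by (intro mult_left_mono) auto
      finally show "cmod (1 / (p - w) - 1 / (q - w)) \<le> cmod (p - q) / \<delta> w ^ 3" by simp
    qed
    show "nrm E (f1 p - f1 q) \<le> (2 * M) * cmod (p - q)"
    proof -
      have "nrm E (f1 p - f1 q) \<le> (2 * cmod (p - q)) * M"
      proof (rule norm_le[OF diff[OF f1[OF pq(1)] f1[OF pq(2)]]])
        fix w assume w: "w \<in> R"
        define u v where "u = 1 / (p - w)" and "v = 1 / (q - w)"
        have uv: "u - v = (q - p) * u * v" "cmod (u * v) \<le> 1 / \<delta> w ^ 2"
          "cmod u \<le> 1 / \<delta> w" "cmod v \<le> 1 / \<delta> w"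
          using dinv[OF pq w] inv2_le[OF pq w] inv_le[OF pq(1) w] inv_le[OF pq(2) w]
          by (simp_all only: u_def v_def)
        \<comment> \<open>Since u - v = (q - p) u v, the difference of squares is p - q times u v (u
          + v): three pole factors, with the constant 2 from u + v.\<close>
        have "- (u ^ 2) - - (v ^ 2) = - ((u - v) * (u + v))"
          by (simp add: power2_eq_square algebra_simps)
        also have "\<dots> = (p - q) * ((u * v) * (u + v))"
          unfolding uv(1) by (simp add: algebra_simps)
        finally have "cmod (- (u ^ 2) - - (v ^ 2)) = cmod (p - q) * (cmod (u * v) * cmod (u + v))"
          by (simp only: norm_mult)
        also have "\<dots> \<le> cmod (p - q) * ((1 / \<delta> w ^ 2) * (1 / \<delta> w + 1 / \<delta> w))"
          using uv \<delta>[OF w] by (intro mult_left_mono mult_mono order.trans[OF norm_triangle_ineq]) auto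
        also have "\<dots> = 2 * cmod (p - q) / \<delta> w ^ 3"
          by (simp add: power2_eq_square power3_eq_cube)
        finally show "cmod (- ((1 / (p - w)) ^ 2) - - ((1 / (q - w)) ^ 2)) \<le> 2 * cmod (p - q) / \<delta> w ^ 3"
          by (simp only: u_def v_def)
      qed
      then show ?thesis by (simp add: mult_ac)
    qed
    show "nrm E (f q - f p - scl E (q - p) (f1 p)) \<le> M * cmod (q - p) ^ 2"
    proof (subst mult.commute, rule norm_le[OF diff[OF diff[OF f[OF pq(2)] f[OF pq(1)]]]])
      show "has_nsum (\<lambda>w. scl E ((q - p) * - ((1 / (p - w)) ^ 2)) (a w)) R (scl E (q - p) (f1 p))"
        using has_nsum_scl[OF _ f1[OF pq(1)], of "q - p"] a by (simp add: scl_scl vecs_scl)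
      fix w assume w: "w \<in> R"
      \<comment> \<open>Exact Taylor remainder of a simple pole: (q - p)^2 / ((p - w)^2 (q - w)).
        Here, as for \<open>f1\<close>, the full cube is used, whereas the Lipschitz bound for
        \<open>f\<close> takes only a square.\<close>
      have "1 / (q - w) - 1 / (p - w) - (q - p) * - ((1 / (p - w)) ^ 2)
          = (q - p) ^ 2 * ((1 / (p - w)) * ((1 / (p - w)) * (1 / (q - w))))"
        using ne[OF pq(1) w] ne[OF pq(2) w] by (simp add: divide_simps) (simp add: power2_eq_square algebra_simps)
      then have "cmod (1 / (q - w) - 1 / (p - w) - (q - p) * - ((1 / (p - w)) ^ 2))
          = cmod (q - p) ^ 2 * (cmod (1 / (p - w)) * cmod ((1 / (p - w)) * (1 / (q - w))))"
        by (simp only: norm_mult norm_power)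
      also have "\<dots> \<le> cmod (q - p) ^ 2 * ((1 / \<delta> w) * (1 / \<delta> w ^ 2))"
        using inv_le[OF pq(1) w] inv2_le[OF pq w] \<delta>[OF w] by (intro mult_left_mono mult_mono) auto
      finally show "cmod (1 / (q - w) - 1 / (p - w) - (q - p) * - ((1 / (p - w)) ^ 2))
          \<le> cmod (q - p) ^ 2 / \<delta> w ^ 3"
        by (simp add: power2_eq_square power3_eq_cube)
    qed
  qed
qed

end

section \<open>Borel-Wolff-Denjoy series\<close>

lemma root_order_props:
  assumes "\<Lambda> \<in> roots_of_unity"
  shows "0 < root_order \<Lambda>" "\<Lambda> ^ root_order \<Lambda> = 1"
proof -
  have "\<exists>m. m \<ge> 1 \<and> \<Lambda> ^ m = 1"
    using assms by (auto simp: roots_of_unity_def)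
  from LeastI_ex[OF this] show "0 < root_order \<Lambda>" "\<Lambda> ^ root_order \<Lambda> = 1"
    by (auto simp: root_order_def)
qed

lemma root_order_dvd_iff:
  assumes "\<Lambda> \<in> roots_of_unity"
  shows "root_order \<Lambda> dvd n \<longleftrightarrow> \<Lambda> ^ n = 1"
proof
  assume "root_order \<Lambda> dvd n"
  then show "\<Lambda> ^ n = 1"
    using root_order_props[OF assms] by (auto simp: power_mult)
next
  assume 1: "\<Lambda> ^ n = 1"
  define m where "m = root_order \<Lambda>"
  have "\<Lambda> ^ n = \<Lambda> ^ (m * (n div m) + n mod m)" by simp
  also have "\<dots> = \<Lambda> ^ (n mod m)"
    using root_order_props[OF assms] unfolding power_add power_mult m_def by simp
  finally have "\<Lambda> ^ (n mod m) = 1" using 1 by simp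
  moreover have "n mod m < m"
    using root_order_props[OF assms] by (simp add: m_def)
  ultimately have "n mod m = 0"
    using not_less_Least[of "n mod m" "\<lambda>m. m \<ge> 1 \<and> \<Lambda> ^ m = 1"]
    unfolding m_def root_order_def by fastforce
  then show "root_order \<Lambda> dvd n"
    by (auto simp: m_def)
qed

text \<open>A finite set of roots is grouped by order. The group of order m consists of solutions of
  z^m = 1, so it has at most m elements, whence the weight \<open>real m\<close>.\<close>

lemma summable_on_roots_of_unity:
  fixes h :: "nat \<Rightarrow> real"
  assumes nonneg: "\<And>m. 0 \<le> h m" and sm: "summable (\<lambda>m. real m * h m)"
  shows "(\<lambda>\<Lambda>. h (root_order \<Lambda>)) summable_on roots_of_unity"
proof (rule nonneg_bdd_above_summable_on)
  have "(\<Sum>\<Lambda>\<in>F. h (root_order \<Lambda>)) \<le> (\<Sum>m. real m * h m)"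
    if F: "F \<subseteq> roots_of_unity" "finite F" for F
  proof -
    have "(\<Sum>\<Lambda>\<in>F. h (root_order \<Lambda>))
        = (\<Sum>m\<in>root_order ` F. \<Sum>\<Lambda>\<in>{\<Lambda>\<in>F. root_order \<Lambda> = m}. h (root_order \<Lambda>))"
      using F by (intro sum.group[symmetric]) auto
    also have "\<dots> \<le> (\<Sum>m\<in>root_order ` F. real m * h m)"
    proof (rule sum_mono)
      fix m assume "m \<in> root_order ` F"
      then have m: "0 < m" using root_order_props F by auto
      have "card {\<Lambda>\<in>F. root_order \<Lambda> = m} \<le> card {z::complex. z ^ m = 1}"
        by (rule card_mono) (use finite_roots_unity[of m, where ?'a = complex] m root_order_props F in auto)
      also have "\<dots> = m" using m by (rule card_roots_unity_eq)
      finally show "(\<Sum>\<Lambda>\<in>{\<Lambda>\<in>F. root_order \<Lambda> = m}. h (root_order \<Lambda>)) \<le> real m * h m"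
        using nonneg[of m] by (simp add: mult_right_mono)
    qed
    also have "\<dots> \<le> (\<Sum>m. real m * h m)"
      using F nonneg by (intro sum_le_suminf sm) auto
    finally show ?thesis .
  qed
  then show "bdd_above (sum (\<lambda>\<Lambda>. h (root_order \<Lambda>)) ` {F. F \<subseteq> roots_of_unity \<and> finite F})"
    by (intro bdd_aboveI[of _ "\<Sum>m. real m * h m"]) auto
qed (use nonneg in auto)

lemma summable_power_times_geometric:
  fixes s :: real
  assumes "0 \<le> s" "s < 1"
  shows "summable (\<lambda>n. real n ^ k * s ^ n)"
proof (rule root_test_convergence')
  have "(\<lambda>n. root n (real n) ^ k * s) \<longlonglongrightarrow> 1 ^ k * s"
    by (intro tendsto_intros LIMSEQ_root)
  moreover have "\<forall>\<^sub>F n in sequentially. root n (real n) ^ k * s = root n (norm (real n ^ k * s ^ n))"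
    using eventually_gt_at_top[of 0]
    by eventually_elim (use assms in \<open>simp add: real_root_mult real_root_power real_root_power_cancel abs_mult\<close>)
  ultimately have "(\<lambda>n. root n (norm (real n ^ k * s ^ n))) \<longlonglongrightarrow> s"
    by (auto intro: Lim_transform_eventually)
  then have "(\<lambda>n. ereal (root n (norm (real n ^ k * s ^ n)))) \<longlonglongrightarrow> ereal s"
    by simp
  then have "limsup (\<lambda>n. ereal (root n (norm (real n ^ k * s ^ n)))) = ereal s"
    by (rule lim_imp_Limsup[OF sequentially_bot])
  then show "limsup (\<lambda>n. ereal (root n (norm (real n ^ k * s ^ n)))) < 1"
    using assms by simp
qed

context complex_normed_space begin

lemma bwd_has_sum_iff:
  assumes "\<And>\<Lambda>. \<Lambda> \<in> roots_of_unity \<Longrightarrow> a \<Lambda> \<in> vecs E"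
  shows "bwd_has_sum E a q s \<longleftrightarrow> has_nsum (\<lambda>\<Lambda>. scl E (1 / (q - \<Lambda>)) (a \<Lambda>)) roots_of_unity s"
  unfolding bwd_has_sum_def by (rule limitin_has_nsum) (use assms in auto)

lemma bwd_sum_eqI:
  assumes "\<And>\<Lambda>. \<Lambda> \<in> roots_of_unity \<Longrightarrow> a \<Lambda> \<in> vecs E" "bwd_has_sum E a q s"
  shows "bwd_sum E a q = s"
  unfolding bwd_sum_def
proof (rule the_equality)
  fix t assume "bwd_has_sum E a q t"
  with assms show "t = s"
    by (auto simp: bwd_has_sum_iff intro: has_nsum_unique[rotated])
qed (rule assms)

lemma bwd_series_K_set:
  fixes \<alpha> :: real
  assumes banach: "complex_banach E" and pos: "0 < \<kappa>" "0 < \<alpha>" "0 < \<gamma> j"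
    and r: "0 < r" "r < exp (- 3 * \<alpha>)" and a: "a \<in> S_space r E"
  shows "\<And>q. q \<in> K_set \<kappa> d \<alpha> \<gamma> j \<Longrightarrow> \<exists>s. bwd_has_sum E a q s"
    and "(\<And>q. q \<in> K_set \<kappa> d \<alpha> \<gamma> j \<Longrightarrow> bwd_has_sum E a q (f q)) \<Longrightarrow> f \<in> C1_hol (K_set \<kappa> d \<alpha> \<gamma> j) E"
proof -
  \<comment> \<open>The inverse cube of the distance contributes e^(3 \<alpha> m), so s is the
    geometric ratio of the majorant; the hypothesis on r is what makes it less than 1.\<close>
  define s where "s = r * exp (3 * \<alpha>)"
  have "s < exp (- 3 * \<alpha>) * exp (3 * \<alpha>)"
    unfolding s_def using r by (intro mult_strict_right_mono) auto
  then have s: "0 < s" "s < 1"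
    using r by (simp_all add: s_def flip: exp_add)
  have av: "a \<Lambda> \<in> vecs E" if "\<Lambda> \<in> roots_of_unity" for \<Lambda>
    using a that by (auto simp: S_space_def)
  obtain C where C: "0 < C" "\<And>\<Lambda>. \<Lambda> \<in> roots_of_unity \<Longrightarrow>
      nrm E (a \<Lambda>) \<le> C * r ^ root_order \<Lambda> / real (root_order \<Lambda>)"
    using a by (auto simp: S_space_def)
  obtain c where c: "0 < c" "c \<le> 1" "\<And>q \<Lambda> m. q \<in> K_set \<kappa> d \<alpha> \<gamma> j \<Longrightarrow> 0 < m \<Longrightarrow> \<Lambda> ^ m = 1 \<Longrightarrow>
      c * exp (- \<alpha> * real m) / real m ^ 2 \<le> cmod (q - \<Lambda>)"
    using K_set_separated[of \<kappa> \<alpha> \<gamma> j d, OF pos] by metis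
  define \<delta> where "\<delta> m = c * exp (- \<alpha> * real m) / real m ^ 2" for m :: nat
  have \<delta>: "0 < \<delta> m" "\<delta> m \<le> 1" if "0 < m" for m
  proof -
    show "0 < \<delta> m" using c that by (simp add: \<delta>_def)
    have "\<delta> m \<le> 1 * 1 / 1"
      unfolding \<delta>_def using c pos that by (intro frac_le mult_mono) auto
    then show "\<delta> m \<le> 1" by simp
  qed
  \<comment> \<open>\<delta>^(-3) brings m^6, and the division by m in \<open>S_space\<close> takes
    one power away.\<close>
  define h where "h m = C / c ^ 3 * (real m ^ 5 * s ^ m)" for m
  have h: "C * r ^ m / real m / \<delta> m ^ 3 = h m" if "0 < m" for m
  proof -
    have "exp (- (\<alpha> * real m)) ^ 3 * exp (3 * \<alpha>) ^ m = 1"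
      by (simp flip: exp_of_nat_mult exp_add)
    then have "1 / exp (- (\<alpha> * real m)) ^ 3 = exp (3 * \<alpha>) ^ m"
      by (simp add: field_simps)
    moreover have "real m ^ 6 = real m * real m ^ 5" by (simp add: eval_nat_numeral)
    ultimately show ?thesis
      using that c unfolding \<delta>_def h_def s_def
      by (simp add: power_divide power_mult_distrib divide_simps flip: power_mult)
  qed
  have sm: "(\<lambda>\<Lambda>. nrm E (a \<Lambda>) / \<delta> (root_order \<Lambda>) ^ 3) summable_on roots_of_unity"
  proof (rule summable_on_comparison_test)
    \<comment> \<open>The sixth power returns because up to m roots share the order m.\<close>
    have "summable (\<lambda>m. C / c ^ 3 * (real m ^ 6 * s ^ m))"
      using s by (intro summable_mult summable_power_times_geometric) auto
    then have "summable (\<lambda>m. real m * h m)"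
      by (simp add: h_def eval_nat_numeral mult_ac)
    then show "(\<lambda>\<Lambda>. h (root_order \<Lambda>)) summable_on roots_of_unity"
      using C c s by (intro summable_on_roots_of_unity) (auto simp: h_def)
    fix \<Lambda> assume \<Lambda>: "\<Lambda> \<in> roots_of_unity"
    note m = root_order_props(1)[OF \<Lambda>]
    show "0 \<le> nrm E (a \<Lambda>) / \<delta> (root_order \<Lambda>) ^ 3"
      using \<delta>[OF m] nrm_nonneg[OF av[OF \<Lambda>]] by simp
    have "nrm E (a \<Lambda>) / \<delta> (root_order \<Lambda>) ^ 3
        \<le> C * r ^ root_order \<Lambda> / real (root_order \<Lambda>) / \<delta> (root_order \<Lambda>) ^ 3"
      using \<delta>[OF m] by (intro divide_right_mono C \<Lambda>) simp
    then show "nrm E (a \<Lambda>) / \<delta> (root_order \<Lambda>) ^ 3 \<le> h (root_order \<Lambda>)"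
      by (simp only: h[OF m])
  qed
  note series = simple_pole_series_C1_hol[where R = roots_of_unity and a = a and
      \<delta> = "\<lambda>\<Lambda>. \<delta> (root_order \<Lambda>)" and C = "K_set \<kappa> d \<alpha> \<gamma> j", OF banach av
      \<delta>(1)[OF root_order_props(1)] \<delta>(2)[OF root_order_props(1)] _ sm]
  have sep: "\<delta> (root_order \<Lambda>) \<le> cmod (q - \<Lambda>)"
    if "q \<in> K_set \<kappa> d \<alpha> \<gamma> j" "\<Lambda> \<in> roots_of_unity" for q \<Lambda>
    unfolding \<delta>_def using c(3)[OF that(1)] root_order_props[OF that(2)] by blast
  show "\<exists>s. bwd_has_sum E a q s" if "q \<in> K_set \<kappa> d \<alpha> \<gamma> j" for q
    using series(1)[OF _ _ _ _ that] sep bwd_has_sum_iff[of a, OF av] by blast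
  assume "\<And>q. q \<in> K_set \<kappa> d \<alpha> \<gamma> j \<Longrightarrow> bwd_has_sum E a q (f q)"
  then show "f \<in> C1_hol (K_set \<kappa> d \<alpha> \<gamma> j) E"
    using series(2)[of f] sep bwd_has_sum_iff[of a, OF av] by blast
qed

end

section \<open>Spaces of bounded operators\<close>

context complex_normed_space begin

lemma complex_banach_iff:
  "complex_banach E \<longleftrightarrow>
    (\<forall>\<sigma>. (\<forall>n. \<sigma> n \<in> vecs E) \<and> (\<forall>\<epsilon>>0. \<exists>N. \<forall>n\<ge>N. \<forall>k\<ge>N. nrm E (\<sigma> n - \<sigma> k) < \<epsilon>) \<longrightarrow>
      (\<exists>s\<in>vecs E. (\<lambda>n. nrm E (\<sigma> n - s)) \<longlonglongrightarrow> 0))"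
proof -
  have "MCauchy \<sigma> \<longleftrightarrow> (\<forall>n. \<sigma> n \<in> vecs E) \<and> (\<forall>\<epsilon>>0. \<exists>N. \<forall>n\<ge>N. \<forall>k\<ge>N. nrm E (\<sigma> n - \<sigma> k) < \<epsilon>)"
    for \<sigma>
    by (auto simp: MCauchy_def ndist_def image_subset_iff)
  moreover have "(\<exists>s. limitin mtopology \<sigma> s sequentially) \<longleftrightarrow>
      (\<exists>s\<in>vecs E. (\<lambda>n. nrm E (\<sigma> n - s)) \<longlonglongrightarrow> 0)" if "\<forall>n. \<sigma> n \<in> vecs E" for \<sigma>
  proof -
    have "limitin mtopology \<sigma> s sequentially \<longleftrightarrow> s \<in> vecs E \<and> (\<lambda>n. nrm E (\<sigma> n - s)) \<longlonglongrightarrow> 0" for s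
      using that by (cases "s \<in> vecs E") (simp_all add: limitin_metric_dist_null ndist_def)
    then show ?thesis by auto
  qed
  ultimately show ?thesis
    using complex_normed by (auto simp: complex_banach_def mcomplete_def)
qed

lemma complex_banachD:
  assumes "complex_banach E" "\<And>n. \<sigma> n \<in> vecs E"
    and "\<And>\<epsilon>. 0 < \<epsilon> \<Longrightarrow> \<exists>N. \<forall>n\<ge>N. \<forall>k\<ge>N. nrm E (\<sigma> n - \<sigma> k) < \<epsilon>"
  shows "\<exists>s\<in>vecs E. (\<lambda>n. nrm E (\<sigma> n - s)) \<longlonglongrightarrow> 0"
  by (rule assms(1)[unfolded complex_banach_iff, THEN spec, THEN mp]) (simp add: assms(2,3))

lemma nrm_tendsto_unique:
  assumes "\<And>n. \<sigma> n \<in> vecs E" "s \<in> vecs E" "t \<in> vecs E"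
    and "(\<lambda>n. nrm E (\<sigma> n - s)) \<longlonglongrightarrow> 0" "(\<lambda>n. nrm E (\<sigma> n - t)) \<longlonglongrightarrow> 0"
  shows "s = t"
proof -
  have "nrm E (s - t) \<le> nrm E (\<sigma> n - s) + nrm E (\<sigma> n - t)" for n
    using nrm_triangle_diff[of s "\<sigma> n" t] nrm_diff_commute[of s "\<sigma> n"] assms by simp
  moreover have "(\<lambda>n. nrm E (\<sigma> n - s) + nrm E (\<sigma> n - t)) \<longlonglongrightarrow> 0"
    using assms by (intro tendsto_add_zero)
  ultimately have "nrm E (s - t) \<le> 0"
    by (intro LIMSEQ_le_const[of _ 0]) auto
  then show ?thesis
    using assms nrm_nonneg[of "s - t"] nrm_eq_0_iff[of "s - t"] by simp
qed

text \<open>Turns a sum in \<open>E\<close> into a scalar one that can be evaluated; it is applied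
  to the map sending an operator to a Taylor coefficient of its value at a fixed function.\<close>

lemma has_sum_functional:
  fixes \<phi> :: "'b \<Rightarrow> complex"
  assumes b: "\<And>i. i \<in> R \<Longrightarrow> b i \<in> vecs E" and s: "has_nsum b R s"
    and add: "\<And>x y. x \<in> vecs E \<Longrightarrow> y \<in> vecs E \<Longrightarrow> \<phi> (x + y) = \<phi> x + \<phi> y"
    and bound: "\<And>x. x \<in> vecs E \<Longrightarrow> cmod (\<phi> x) \<le> M * nrm E x"
  shows "((\<lambda>i. \<phi> (b i)) has_sum \<phi> s) R"
proof -
  have sv: "s \<in> vecs E" and lim: "((\<lambda>X. nrm E (sum b X - s)) \<longlongrightarrow> 0) (finite_subsets_at_top R)"
    using s by (auto simp: has_nsum_def)
  have zero: "\<phi> 0 = 0"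
    using add[of 0 0] by simp
  have sum: "\<phi> (sum b X) = (\<Sum>i\<in>X. \<phi> (b i))" if "X \<subseteq> R" for X
    using that
  proof (induction X rule: infinite_finite_induct)
    case (insert i X)
    then have "b i \<in> vecs E" "sum b X \<in> vecs E"
      using b by auto
    with insert show ?case by (simp add: add)
  qed (auto simp: zero)
  have "cmod ((\<Sum>i\<in>X. \<phi> (b i)) - \<phi> s) \<le> M * nrm E (sum b X - s)" if "X \<subseteq> R" for X
  proof -
    have v: "sum b X \<in> vecs E" using b that by auto
    have "\<phi> (sum b X) = \<phi> (sum b X - s) + \<phi> s"
      using add[of "sum b X - s" s] v sv by simp
    then show ?thesis
      using bound[of "sum b X - s"] v sv sum[OF that] by simp
  qed
  then have "\<forall>\<^sub>F X in finite_subsets_at_top R. cmod ((\<Sum>i\<in>X. \<phi> (b i)) - \<phi> s) \<le> M * nrm E (sum b X - s)"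
    by (intro eventually_finite_subsets_at_top_weakI)
  then have "((\<lambda>X. (\<Sum>i\<in>X. \<phi> (b i)) - \<phi> s) \<longlongrightarrow> 0) (finite_subsets_at_top R)"
    by (rule Lim_null_comparison) (use lim in \<open>rule tendsto_mult_right_zero\<close>)
  then show ?thesis
    by (simp add: has_sum_def LIM_zero_iff)
qed

end

locale two_complex_normed_spaces =
  e: complex_normed_space E + g: complex_normed_space G
  for E :: "'a::ab_group_add nspace" and G :: "'b::ab_group_add nspace"
begin

lemma bounded_ops_iff:
  "T \<in> vecs (bounded_ops E G) \<longleftrightarrow>
     (\<forall>x\<in>vecs E. T x \<in> vecs G) \<and>
     (\<forall>x\<in>vecs E. \<forall>y\<in>vecs E. T (x + y) = T x + T y) \<and>
     (\<forall>c. \<forall>x\<in>vecs E. T (scl E c x) = scl G c (T x)) \<and>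
     (\<exists>M. \<forall>x\<in>vecs E. nrm G (T x) \<le> M * nrm E x) \<and>
     (\<forall>x. x \<notin> vecs E \<longrightarrow> T x = 0)"
  by (simp add: bounded_ops_def)

lemma scl_bounded_ops [simp]: "scl (bounded_ops E G) c T x = scl G c (T x)"
  by (simp add: bounded_ops_def)

lemma bdd_above_op:
  assumes "T \<in> vecs (bounded_ops E G)"
  shows "bdd_above ((\<lambda>x. nrm G (T x) / nrm E x) ` vecs E)"
proof -
  obtain M where M: "\<forall>x\<in>vecs E. nrm G (T x) \<le> M * nrm E x"
    using assms by (auto simp: bounded_ops_iff)
  \<comment> \<open>The absolute value covers y = 0, where the quotient is 0 by the division
    convention while M may be negative if the space is trivial.\<close>
  have "nrm G (T y) / nrm E y \<le> \<bar>M\<bar>" if "y \<in> vecs E" for y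
  proof (cases "nrm E y = 0")
    case False
    then have "0 < nrm E y" using e.nrm_nonneg[OF that] by simp
    then have "nrm G (T y) / nrm E y \<le> M"
      using M that by (simp add: divide_le_eq)
    then show ?thesis by linarith
  qed simp
  then show ?thesis
    by (intro bdd_aboveI2)
qed

lemma nrm_op_le:
  assumes "T \<in> vecs (bounded_ops E G)" "x \<in> vecs E"
  shows "nrm G (T x) \<le> nrm (bounded_ops E G) T * nrm E x"
proof (cases "nrm E x = 0")
  case True
  obtain M where "\<forall>x\<in>vecs E. nrm G (T x) \<le> M * nrm E x"
    using assms by (auto simp: bounded_ops_iff)
  with True assms have "nrm G (T x) \<le> M * 0" by metis
  with True show ?thesis by simp
next
  case False
  have "nrm G (T x) / nrm E x \<le> nrm (bounded_ops E G) T"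
    using cSUP_upper[OF assms(2) bdd_above_op[OF assms(1)]] by (simp add: bounded_ops_def)
  moreover have "0 < nrm E x" using False e.nrm_nonneg[OF assms(2)] by simp
  ultimately show ?thesis by (simp add: divide_le_eq)
qed

lemma nrm_op_leI:
  assumes "0 \<le> M" "\<And>x. x \<in> vecs E \<Longrightarrow> nrm G (T x) \<le> M * nrm E x"
  shows "nrm (bounded_ops E G) T \<le> M"
  unfolding bounded_ops_def nspace.select_convs
proof (rule cSUP_least)
  show "vecs E \<noteq> {}" using e.vecs_zero by blast
  show "nrm G (T x) / nrm E x \<le> M" if "x \<in> vecs E" for x
  proof (cases "nrm E x = 0")
    case False
    then have "0 < nrm E x" using e.nrm_nonneg[OF that] by simp
    then show ?thesis using assms(2)[OF that] by (simp add: divide_le_eq)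
  qed (use assms in simp)
qed

lemma nrm_op_nonneg:
  assumes "T \<in> vecs (bounded_ops E G)"
  shows "0 \<le> nrm (bounded_ops E G) T"
  using cSUP_upper[OF e.vecs_zero bdd_above_op[OF assms]] by (simp add: bounded_ops_def)

lemma complex_normed_bounded_ops: "complex_normed (bounded_ops E G)"
proof -
  have vs: "vector_space (scl (bounded_ops E G))"
    using g.vector_space unfolding vector_space_def by (auto simp: fun_eq_iff)
  have "module.subspace (scl (bounded_ops E G)) (vecs (bounded_ops E G))"
  proof (subst module.subspace_def, use vs in \<open>simp add: module_iff_vector_space\<close>, intro conjI ballI allI)
    show "0 \<in> vecs (bounded_ops E G)"
      by (auto simp: bounded_ops_iff module.scale_zero_right[OF g.module_scl] intro!: exI[of _ 0])
  next
    fix S T assume S: "S \<in> vecs (bounded_ops E G)" and T: "T \<in> vecs (bounded_ops E G)"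
    have "nrm G (S x + T x) \<le> (nrm (bounded_ops E G) S + nrm (bounded_ops E G) T) * nrm E x"
      if "x \<in> vecs E" for x
    proof -
      have "nrm G (S x + T x) \<le> nrm G (S x) + nrm G (T x)"
        using S T that by (intro g.nrm_triangle) (auto simp: bounded_ops_iff)
      with nrm_op_le[OF S that] nrm_op_le[OF T that] show ?thesis
        by (simp add: distrib_right)
    qed
    with S T show "S + T \<in> vecs (bounded_ops E G)"
      unfolding bounded_ops_iff
      by (auto simp: module.scale_right_distrib[OF g.module_scl] add_ac)
  next
    fix c T assume T: "T \<in> vecs (bounded_ops E G)"
    have "nrm G (scl G c (T x)) \<le> (cmod c * nrm (bounded_ops E G) T) * nrm E x" if "x \<in> vecs E" for x
      using mult_left_mono[OF nrm_op_le[OF T that], of "cmod c"] T that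
      by (simp add: bounded_ops_iff g.nrm_scl mult_ac)
    then have "\<exists>M. \<forall>x\<in>vecs E. nrm G (scl G c (T x)) \<le> M * nrm E x"
      by blast
    with T show "scl (bounded_ops E G) c T \<in> vecs (bounded_ops E G)"
      unfolding bounded_ops_iff
      by (auto simp: module.scale_right_distrib[OF g.module_scl] g.scl_scl mult_ac
          module.scale_zero_right[OF g.module_scl])
  qed
  note sub = this
  note add = module.subspace_add[OF vs[folded module_iff_vector_space] sub]
  note scale = module.subspace_scale[OF vs[folded module_iff_vector_space] sub]
  have triangle: "nrm (bounded_ops E G) (S + T) \<le> nrm (bounded_ops E G) S + nrm (bounded_ops E G) T"
    if S: "S \<in> vecs (bounded_ops E G)" and T: "T \<in> vecs (bounded_ops E G)" for S T
  proof (rule nrm_op_leI)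
    show "0 \<le> nrm (bounded_ops E G) S + nrm (bounded_ops E G) T"
      using S T by (intro add_nonneg_nonneg nrm_op_nonneg)
    fix x assume x: "x \<in> vecs E"
    have "nrm G (S x + T x) \<le> nrm G (S x) + nrm G (T x)"
      using S T x by (intro g.nrm_triangle) (auto simp: bounded_ops_iff)
    with nrm_op_le[OF S x] nrm_op_le[OF T x]
    show "nrm G ((S + T) x) \<le> (nrm (bounded_ops E G) S + nrm (bounded_ops E G) T) * nrm E x"
      by (simp add: distrib_right)
  qed
  have zero: "nrm (bounded_ops E G) T = 0 \<longleftrightarrow> T = 0" if T: "T \<in> vecs (bounded_ops E G)" for T
  proof
    assume 0: "nrm (bounded_ops E G) T = 0"
    have "T x = 0" for x
    proof (cases "x \<in> vecs E")
      case True
      then have "nrm G (T x) \<le> 0" using nrm_op_le[OF T True] 0 by simp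
      then show ?thesis
        using T True g.nrm_nonneg[of "T x"] g.nrm_eq_0_iff[of "T x"] by (auto simp: bounded_ops_iff)
    qed (use T in \<open>auto simp: bounded_ops_iff\<close>)
    then show "T = 0" by (simp add: fun_eq_iff)
  next
    assume "T = 0"
    then have "nrm (bounded_ops E G) T \<le> 0"
      by (intro nrm_op_leI) auto
    with nrm_op_nonneg[OF T] show "nrm (bounded_ops E G) T = 0" by simp
  qed
  have scl_le: "nrm (bounded_ops E G) (scl (bounded_ops E G) c T) \<le> cmod c * nrm (bounded_ops E G) T"
    if T: "T \<in> vecs (bounded_ops E G)" for c T
    using mult_left_mono[OF nrm_op_le[OF T], of _ "cmod c"] T nrm_op_nonneg[OF T]
    by (intro nrm_op_leI) (auto simp: bounded_ops_iff g.nrm_scl mult_ac)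
  \<comment> \<open>Equality for nonzero c comes from applying the inequality a second time, to 1 /
    c and the scaled operator.\<close>
  have scl_eq: "nrm (bounded_ops E G) (scl (bounded_ops E G) c T) = cmod c * nrm (bounded_ops E G) T"
    if T: "T \<in> vecs (bounded_ops E G)" for c T
  proof (cases "c = 0")
    case True
    then show ?thesis
      using scl_le[OF T, of c] nrm_op_nonneg[OF scale[OF T]] by (metis antisym mult_zero_left norm_zero)
  next
    case False
    have "scl (bounded_ops E G) (1 / c) (scl (bounded_ops E G) c T) = T"
      using False by (simp add: fun_eq_iff g.scl_scl module.scale_one[OF g.module_scl])
    then have "nrm (bounded_ops E G) T \<le> cmod (1 / c) * nrm (bounded_ops E G) (scl (bounded_ops E G) c T)"
      using scl_le[OF scale[OF T, of c], of "1 / c"] by simp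
    then show ?thesis
      using False scl_le[OF T, of c] by (simp add: norm_divide field_simps)
  qed
  show ?thesis
    unfolding complex_normed_def
    using vs sub nrm_op_nonneg zero triangle scl_eq by blast
qed

sublocale op: complex_normed_space "bounded_ops E G"
  by unfold_locales (rule complex_normed_bounded_ops)

text \<open>The candidate is the pointwise limit. Letting one index of the Cauchy estimate tend to
  infinity at fixed \<open>x\<close> gives \<open>close\<close>, an error at most \<epsilon>
  \<open>nrm E x\<close> for all \<open>x\<close> at once; this yields both boundedness of the limit
  and convergence in operator norm.\<close>

lemma complex_banach_bounded_ops:
  assumes "complex_banach G"
  shows "complex_banach (bounded_ops E G)"
  unfolding op.complex_banach_iff
proof (intro allI impI, elim conjE)
  fix \<sigma> :: "nat \<Rightarrow> 'a \<Rightarrow> 'b"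
  assume "\<forall>n. \<sigma> n \<in> vecs (bounded_ops E G)"
  then have \<sigma>: "\<And>n. \<sigma> n \<in> vecs (bounded_ops E G)" by blast
  assume cauchy: "\<forall>\<epsilon>>0. \<exists>N. \<forall>n\<ge>N. \<forall>k\<ge>N. nrm (bounded_ops E G) (\<sigma> n - \<sigma> k) < \<epsilon>"
  have \<sigma>G: "\<sigma> n x \<in> vecs G" if "x \<in> vecs E" for n x
    using \<sigma>[of n] that by (auto simp: bounded_ops_iff)
  have "\<exists>l\<in>vecs G. (\<lambda>n. nrm G (\<sigma> n x - l)) \<longlonglongrightarrow> 0" if x: "x \<in> vecs E" for x
  proof -
    have "\<exists>N. \<forall>n\<ge>N. \<forall>k\<ge>N. nrm G (\<sigma> n x - \<sigma> k x) < \<epsilon>" if "0 < \<epsilon>" for \<epsilon>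
    proof -
      \<comment> \<open>The summand 1 avoids a zero denominator at x = 0.\<close>
      have pos: "0 < nrm E x + 1" using e.nrm_nonneg[OF x] by simp
      then have "0 < \<epsilon> / (nrm E x + 1)" using \<open>0 < \<epsilon>\<close> by simp
      with cauchy obtain N where N: "\<forall>n\<ge>N. \<forall>k\<ge>N. nrm (bounded_ops E G) (\<sigma> n - \<sigma> k) < \<epsilon> / (nrm E x + 1)"
        by blast
      have "nrm G (\<sigma> n x - \<sigma> k x) < \<epsilon>" if "n \<ge> N" "k \<ge> N" for n k
      proof -
        have "nrm G ((\<sigma> n - \<sigma> k) x) \<le> nrm (bounded_ops E G) (\<sigma> n - \<sigma> k) * nrm E x"
          by (rule nrm_op_le[OF op.vecs_diff[OF \<sigma> \<sigma>] x])
        also have "\<dots> \<le> nrm (bounded_ops E G) (\<sigma> n - \<sigma> k) * (nrm E x + 1)"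
          using op.nrm_nonneg[OF op.vecs_diff[OF \<sigma> \<sigma>]] by (intro mult_left_mono) auto
        also have "\<dots> < \<epsilon>"
          using N that pos by (simp add: pos_less_divide_eq)
        finally show ?thesis by simp
      qed
      then show ?thesis by blast
    qed
    then show ?thesis
      by (rule g.complex_banachD[OF assms \<sigma>G[OF x]])
  qed
  then obtain l where l: "\<And>x. x \<in> vecs E \<Longrightarrow> l x \<in> vecs G"
    "\<And>x. x \<in> vecs E \<Longrightarrow> (\<lambda>n. nrm G (\<sigma> n x - l x)) \<longlonglongrightarrow> 0"
    by metis
  \<comment> \<open>Extension by 0 off the carrier, as membership in \<open>bounded_ops\<close>
    demands.\<close>
  define L where "L x = (if x \<in> vecs E then l x else 0)" for x
  have L: "L x \<in> vecs G" "(\<lambda>n. nrm G (\<sigma> n x - L x)) \<longlonglongrightarrow> 0" if "x \<in> vecs E" for x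
    using l that by (auto simp: L_def)
  have close: "\<exists>N. \<forall>n\<ge>N. \<forall>x\<in>vecs E. nrm G (\<sigma> n x - L x) \<le> \<epsilon> * nrm E x" if \<epsilon>: "0 < \<epsilon>" for \<epsilon>
  proof -
    obtain N where N: "\<forall>n\<ge>N. \<forall>k\<ge>N. nrm (bounded_ops E G) (\<sigma> n - \<sigma> k) < \<epsilon>"
      using cauchy \<epsilon> by blast
    have "nrm G (\<sigma> n x - L x) \<le> \<epsilon> * nrm E x" if n: "n \<ge> N" and x: "x \<in> vecs E" for n x
    proof (rule LIMSEQ_le_const)
      show "(\<lambda>k. \<epsilon> * nrm E x + nrm G (\<sigma> k x - L x)) \<longlonglongrightarrow> \<epsilon> * nrm E x"
        using tendsto_add[OF tendsto_const L(2)[OF x], of "\<epsilon> * nrm E x"] by simp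
      have "nrm G (\<sigma> n x - L x) \<le> \<epsilon> * nrm E x + nrm G (\<sigma> k x - L x)" if "k \<ge> N" for k
      proof -
        have "nrm G ((\<sigma> n - \<sigma> k) x) \<le> nrm (bounded_ops E G) (\<sigma> n - \<sigma> k) * nrm E x"
          by (rule nrm_op_le[OF op.vecs_diff[OF \<sigma> \<sigma>] x])
        also have "\<dots> \<le> \<epsilon> * nrm E x"
          using N n that e.nrm_nonneg[OF x] by (intro mult_right_mono) (auto simp: less_imp_le)
        finally have "nrm G (\<sigma> n x - \<sigma> k x) \<le> \<epsilon> * nrm E x" by simp
        then show ?thesis
          using g.nrm_triangle_diff[OF \<sigma>G[OF x] \<sigma>G[OF x] L(1)[OF x], of n k] by linarith
      qed
      then show "\<exists>N. \<forall>k\<ge>N. nrm G (\<sigma> n x - L x) \<le> \<epsilon> * nrm E x + nrm G (\<sigma> k x - L x)"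
        by blast
    qed
    then show ?thesis by blast
  qed
  have "L \<in> vecs (bounded_ops E G)"
    unfolding bounded_ops_iff
  proof (intro conjI ballI allI impI)
    show "L x \<in> vecs G" if "x \<in> vecs E" for x by (rule L(1)[OF that])
    show "L x = 0" if "x \<notin> vecs E" for x using that by (simp add: L_def)
    fix x y assume xy: "x \<in> vecs E" "y \<in> vecs E"
    show "L (x + y) = L x + L y"
    proof (rule g.nrm_tendsto_unique[where \<sigma> = "\<lambda>n. \<sigma> n (x + y)"])
      have lim: "(\<lambda>n. nrm G (\<sigma> n x - L x) + nrm G (\<sigma> n y - L y)) \<longlonglongrightarrow> 0"
        by (intro tendsto_add_zero L xy)
      have "nrm G (\<sigma> n (x + y) - (L x + L y)) \<le> nrm G (\<sigma> n x - L x) + nrm G (\<sigma> n y - L y)" for n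
      proof -
        have "\<sigma> n (x + y) = \<sigma> n x + \<sigma> n y"
          using \<sigma>[of n] xy by (simp add: bounded_ops_iff)
        then have "\<sigma> n (x + y) - (L x + L y) = (\<sigma> n x - L x) + (\<sigma> n y - L y)"
          by simp
        then show ?thesis
          using g.nrm_triangle[OF g.vecs_diff[OF \<sigma>G[OF xy(1)] L(1)[OF xy(1)]]
              g.vecs_diff[OF \<sigma>G[OF xy(2)] L(1)[OF xy(2)]], of n n] by (simp only:)
      qed
      moreover have "0 \<le> nrm G (\<sigma> n (x + y) - (L x + L y))" for n
        by (intro g.nrm_nonneg g.vecs_diff g.vecs_add \<sigma>G L e.vecs_add xy)
      ultimately show "(\<lambda>n. nrm G (\<sigma> n (x + y) - (L x + L y))) \<longlonglongrightarrow> 0"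
        by (intro Lim_null_comparison[OF always_eventually lim]) simp
    qed (use \<sigma>G L xy in auto)
  next
    fix c x assume x: "x \<in> vecs E"
    show "L (scl E c x) = scl G c (L x)"
    proof (rule g.nrm_tendsto_unique[where \<sigma> = "\<lambda>n. \<sigma> n (scl E c x)"])
      have "nrm G (\<sigma> n (scl E c x) - scl G c (L x)) = cmod c * nrm G (\<sigma> n x - L x)" for n
        using \<sigma>[of n] x \<sigma>G L by (simp add: bounded_ops_iff g.nrm_scl flip: g.scl_right_diff)
      then show "(\<lambda>n. nrm G (\<sigma> n (scl E c x) - scl G c (L x))) \<longlonglongrightarrow> 0"
        using tendsto_mult_right_zero[OF L(2)[OF x]] by simp
    qed (use \<sigma>G L x in auto)
  next
    obtain N where N: "\<forall>n\<ge>N. \<forall>x\<in>vecs E. nrm G (\<sigma> n x - L x) \<le> 1 * nrm E x"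
      using close[of 1] by auto
    have "nrm G (L x) \<le> (nrm (bounded_ops E G) (\<sigma> N) + 1) * nrm E x" if x: "x \<in> vecs E" for x
    proof -
      have "nrm G (L x) \<le> nrm G (L x - \<sigma> N x) + nrm G (\<sigma> N x)"
        using g.nrm_triangle_diff[OF L(1)[OF x] \<sigma>G[OF x] g.vecs_zero] by simp
      moreover have "nrm G (L x - \<sigma> N x) \<le> 1 * nrm E x"
        using N x g.nrm_diff_commute[OF L(1)[OF x] \<sigma>G[OF x], of N] by auto
      ultimately show ?thesis
        using nrm_op_le[OF \<sigma>[of N] x] by (simp add: algebra_simps)
    qed
    then show "\<exists>M. \<forall>x\<in>vecs E. nrm G (L x) \<le> M * nrm E x" by blast
  qed
  moreover have "(\<lambda>n. nrm (bounded_ops E G) (\<sigma> n - L)) \<longlonglongrightarrow> 0"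
  proof (rule LIMSEQ_I)
    fix \<epsilon> :: real assume "0 < \<epsilon>"
    then obtain N where N: "\<forall>n\<ge>N. \<forall>x\<in>vecs E. nrm G (\<sigma> n x - L x) \<le> \<epsilon> / 2 * nrm E x"
      using close[of "\<epsilon> / 2"] by auto
    have "norm (nrm (bounded_ops E G) (\<sigma> n - L) - 0) < \<epsilon>" if "n \<ge> N" for n
    proof -
      have "nrm (bounded_ops E G) (\<sigma> n - L) \<le> \<epsilon> / 2"
        using N that \<open>0 < \<epsilon>\<close> by (intro nrm_op_leI) auto
      with op.nrm_nonneg[OF op.vecs_diff[OF \<sigma> \<open>L \<in> vecs (bounded_ops E G)\<close>], of n] \<open>0 < \<epsilon>\<close>
      show ?thesis by simp
    qed
    then show "\<exists>N. \<forall>n\<ge>N. norm (nrm (bounded_ops E G) (\<sigma> n - L) - 0) < \<epsilon>" by blast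
  qed
  ultimately show "\<exists>s\<in>vecs (bounded_ops E G). (\<lambda>n. nrm (bounded_ops E G) (\<sigma> n - s)) \<longlonglongrightarrow> 0"
    by blast
qed

end

section \<open>Bounded holomorphic functions on a disk\<close>

context
  fixes r :: real
  assumes r: "0 < r"
begin

lemma Hinf0_iff:
  "g \<in> vecs (Hinf0 r) \<longleftrightarrow> g holomorphic_on ball 0 r \<and> bounded (g ` ball 0 r) \<and> g 0 = 0 \<and>
     (\<forall>z. z \<notin> ball 0 r \<longrightarrow> g z = 0)"
  by (simp add: Hinf0_def)

lemma scl_Hinf0: "scl (Hinf0 r) c g = (\<lambda>z. c * g z)"
  by (simp add: Hinf0_def)

text \<open>The bound holds at every \<open>z\<close>: off the disk the value is 0, which is also
  the value at the centre.\<close>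

lemma Hinf0_norm_ge:
  assumes "g \<in> vecs (Hinf0 r)"
  shows "cmod (g z) \<le> nrm (Hinf0 r) g"
proof -
  have bdd: "bdd_above ((\<lambda>z. cmod (g z)) ` ball 0 r)"
    using assms by (auto simp: Hinf0_iff bounded_iff bdd_above_def)
  have le: "cmod (g z) \<le> nrm (Hinf0 r) g" if "z \<in> ball 0 r" for z
    unfolding Hinf0_def nspace.select_convs using bdd that by (intro cSUP_upper)
  show ?thesis
  proof (cases "z \<in> ball 0 r")
    case False
    then have "cmod (g z) = cmod (g 0)" using assms by (simp add: Hinf0_iff)
    with le[of 0] r show ?thesis by simp
  qed (rule le)
qed

lemma Hinf0_norm_leI: "(\<And>z. z \<in> ball 0 r \<Longrightarrow> cmod (g z) \<le> M) \<Longrightarrow> nrm (Hinf0 r) g \<le> M"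
  unfolding Hinf0_def nspace.select_convs using r by (intro cSUP_least) auto

lemma complex_normed_Hinf0: "complex_normed (Hinf0 r)"
proof -
  have vs: "vector_space (scl (Hinf0 r))"
    by unfold_locales (auto simp: scl_Hinf0 fun_eq_iff algebra_simps)
  have "module.subspace (scl (Hinf0 r)) (vecs (Hinf0 r))"
  proof (subst module.subspace_def, use vs in \<open>simp add: module_iff_vector_space\<close>, intro conjI ballI allI)
    show "0 \<in> vecs (Hinf0 r)"
      by (auto simp: Hinf0_iff zero_fun_def image_constant_conv)
  next
    fix f g assume fg: "f \<in> vecs (Hinf0 r)" "g \<in> vecs (Hinf0 r)"
    have "bounded ((\<lambda>z. f z + g z) ` ball 0 r)"
      using fg by (intro bounded_plus_comp) (auto simp: Hinf0_iff)
    moreover have "(\<lambda>z. f z + g z) holomorphic_on ball 0 r"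
      using fg by (intro holomorphic_intros) (auto simp: Hinf0_iff)
    ultimately show "f + g \<in> vecs (Hinf0 r)"
      using fg by (simp add: Hinf0_iff plus_fun_def)
  next
    fix c g assume g: "g \<in> vecs (Hinf0 r)"
    have "bounded ((\<lambda>z. c * z) ` (g ` ball 0 r))"
      using g by (intro bounded_linear_image[OF _ bounded_linear_mult_right]) (auto simp: Hinf0_iff)
    moreover have "(\<lambda>z. c * g z) holomorphic_on ball 0 r"
      using g by (intro holomorphic_intros) (auto simp: Hinf0_iff)
    ultimately show "scl (Hinf0 r) c g \<in> vecs (Hinf0 r)"
      using g by (simp add: Hinf0_iff scl_Hinf0 image_image)
  qed
  note sub = this
  have scl_le: "nrm (Hinf0 r) (scl (Hinf0 r) c g) \<le> cmod c * nrm (Hinf0 r) g"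
    if "g \<in> vecs (Hinf0 r)" for c g
    by (rule Hinf0_norm_leI) (use Hinf0_norm_ge[OF that] in \<open>auto simp: scl_Hinf0 norm_mult intro: mult_left_mono\<close>)
  have nonneg: "0 \<le> nrm (Hinf0 r) g" if "g \<in> vecs (Hinf0 r)" for g
    using Hinf0_norm_ge[OF that, of 0] norm_ge_zero[of "g 0"] by linarith
  have scl_eq: "nrm (Hinf0 r) (scl (Hinf0 r) c g) = cmod c * nrm (Hinf0 r) g"
    if g: "g \<in> vecs (Hinf0 r)" for c g
  proof (cases "c = 0")
    case True
    then show ?thesis
      using scl_le[OF g, of c] nonneg[OF module.subspace_scale[OF vs[folded module_iff_vector_space] sub g], of c]
      by simp
  next
    case False
    have "scl (Hinf0 r) (1 / c) (scl (Hinf0 r) c g) = g"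
      using False by (simp add: scl_Hinf0)
    then have "nrm (Hinf0 r) g \<le> cmod (1 / c) * nrm (Hinf0 r) (scl (Hinf0 r) c g)"
      using scl_le[OF module.subspace_scale[OF vs[folded module_iff_vector_space] sub g, of c], of "1 / c"] by simp
    then show ?thesis
      using False scl_le[OF g, of c] by (simp add: norm_divide field_simps)
  qed
  have zero: "nrm (Hinf0 r) g = 0 \<longleftrightarrow> g = 0" if g: "g \<in> vecs (Hinf0 r)" for g
  proof
    assume "nrm (Hinf0 r) g = 0"
    then have "cmod (g z) \<le> 0" for z using Hinf0_norm_ge[OF g, of z] by simp
    then show "g = 0" by (simp add: fun_eq_iff)
  next
    assume "g = 0"
    then have "nrm (Hinf0 r) g \<le> 0" by (intro Hinf0_norm_leI) simp
    with nonneg[OF g] show "nrm (Hinf0 r) g = 0" by simp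
  qed
  have triangle: "nrm (Hinf0 r) (f + g) \<le> nrm (Hinf0 r) f + nrm (Hinf0 r) g"
    if "f \<in> vecs (Hinf0 r)" "g \<in> vecs (Hinf0 r)" for f g
  proof (rule Hinf0_norm_leI)
    show "cmod ((f + g) z) \<le> nrm (Hinf0 r) f + nrm (Hinf0 r) g" for z
      using norm_triangle_ineq[of "f z" "g z"] Hinf0_norm_ge[OF that(1), of z] Hinf0_norm_ge[OF that(2), of z]
      by simp
  qed
  show ?thesis
    unfolding complex_normed_def
    using vs sub nonneg zero triangle scl_eq by blast
qed

interpretation H: complex_normed_space "Hinf0 r"
  by unfold_locales (rule complex_normed_Hinf0)

lemma complex_banach_Hinf0: "complex_banach (Hinf0 r)"
  unfolding H.complex_banach_iff
proof (intro allI impI, elim conjE)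
  fix \<sigma> :: "nat \<Rightarrow> complex \<Rightarrow> complex"
  assume "\<forall>n. \<sigma> n \<in> vecs (Hinf0 r)"
  then have \<sigma>: "\<And>n. \<sigma> n \<in> vecs (Hinf0 r)" by blast
  assume cauchy: "\<forall>\<epsilon>>0. \<exists>N. \<forall>n\<ge>N. \<forall>k\<ge>N. nrm (Hinf0 r) (\<sigma> n - \<sigma> k) < \<epsilon>"
  \<comment> \<open>Working on the whole plane, one uniform limit yields holomorphy in the disk, the
    zero at the centre and the zero values outside.\<close>
  have "uniformly_Cauchy_on UNIV \<sigma>"
    unfolding uniformly_Cauchy_on_def
  proof (intro allI impI)
    fix \<epsilon> :: real assume "0 < \<epsilon>"
    then obtain N where N: "\<forall>n\<ge>N. \<forall>k\<ge>N. nrm (Hinf0 r) (\<sigma> n - \<sigma> k) < \<epsilon>"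
      using cauchy by blast
    have "dist (\<sigma> m z) (\<sigma> n z) < \<epsilon>" if "m \<ge> N" "n \<ge> N" for m n z
    proof -
      have "cmod ((\<sigma> m - \<sigma> n) z) \<le> nrm (Hinf0 r) (\<sigma> m - \<sigma> n)"
        by (rule Hinf0_norm_ge[OF H.vecs_diff[OF \<sigma> \<sigma>]])
      also have "\<dots> < \<epsilon>" using N that by blast
      finally show ?thesis by (simp add: dist_norm)
    qed
    then show "\<exists>M. \<forall>z\<in>UNIV. \<forall>m\<ge>M. \<forall>n\<ge>M. dist (\<sigma> m z) (\<sigma> n z) < \<epsilon>" by blast
  qed
  then obtain L where L: "uniform_limit UNIV \<sigma> L sequentially"
    using Cauchy_uniformly_convergent by (auto simp: uniformly_convergent_on_def)
  have close: "\<exists>N. \<forall>n\<ge>N. \<forall>z. cmod (\<sigma> n z - L z) < \<epsilon>" if "0 < \<epsilon>" for \<epsilon>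
    using uniform_limitD[OF L that] by (auto simp: eventually_sequentially dist_norm)
  have zero: "L z = 0" if "\<And>n. \<sigma> n z = 0" for z
    using tendsto_uniform_limitI[OF L, of z] that by (simp add: LIMSEQ_const_iff)
  have Lv: "L \<in> vecs (Hinf0 r)"
    unfolding Hinf0_iff
  proof (intro conjI allI impI)
    show "L holomorphic_on ball 0 r"
    proof (rule holomorphic_uniform_sequence)
      show "\<sigma> n holomorphic_on ball 0 r" for n using \<sigma>[of n] by (simp add: Hinf0_iff)
      show "\<exists>d>0. cball x d \<subseteq> ball 0 r \<and> uniform_limit (cball x d) \<sigma> L sequentially"
        if "x \<in> ball 0 r" for x
        using open_contains_cball[of "ball 0 r"] that uniform_limit_on_subset[OF L] by (metis open_ball subset_UNIV)
    qed simp
    obtain N where N: "\<forall>n\<ge>N. \<forall>z. cmod (\<sigma> n z - L z) < 1" using close[of 1] by auto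
    have "cmod (L z) \<le> nrm (Hinf0 r) (\<sigma> N) + 1" for z
    proof -
      have "cmod (L z) \<le> cmod (\<sigma> N z) + cmod (\<sigma> N z - L z)"
        by (metis norm_triangle_sub norm_minus_commute)
      moreover have "cmod (\<sigma> N z - L z) < 1" using N by blast
      ultimately show ?thesis using Hinf0_norm_ge[OF \<sigma>[of N], of z] by linarith
    qed
    then show "bounded (L ` ball 0 r)" by (auto simp: bounded_iff)
  qed (use \<sigma> zero in \<open>auto simp: Hinf0_iff\<close>)
  moreover have "(\<lambda>n. nrm (Hinf0 r) (\<sigma> n - L)) \<longlonglongrightarrow> 0"
  proof (rule LIMSEQ_I)
    fix \<epsilon> :: real assume e: "0 < \<epsilon>"
    then obtain N where N: "\<forall>n\<ge>N. \<forall>z. cmod (\<sigma> n z - L z) < \<epsilon> / 2"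
      using close[of "\<epsilon> / 2"] by auto
    have "norm (nrm (Hinf0 r) (\<sigma> n - L) - 0) < \<epsilon>" if "n \<ge> N" for n
    proof -
      have "nrm (Hinf0 r) (\<sigma> n - L) \<le> \<epsilon> / 2"
        by (rule Hinf0_norm_leI) (use N that in \<open>auto simp: less_imp_le\<close>)
      with H.nrm_nonneg[OF H.vecs_diff[OF \<sigma> Lv], of n] e show ?thesis by simp
    qed
    then show "\<exists>N. \<forall>n\<ge>N. norm (nrm (Hinf0 r) (\<sigma> n - L) - 0) < \<epsilon>" by blast
  qed
  ultimately show "\<exists>s\<in>vecs (Hinf0 r). (\<lambda>n. nrm (Hinf0 r) (\<sigma> n - s)) \<longlonglongrightarrow> 0"
    by blast
qed

lemma Hinf0_has_fps_expansion:
  assumes "g \<in> vecs (Hinf0 r)"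
  shows "g has_fps_expansion fps_expansion g 0"
  by (rule has_fps_expansion_fps_expansion[of "ball 0 r"]) (use assms r in \<open>auto simp: Hinf0_iff\<close>)

lemma Hinf0_eval_fps:
  assumes "g \<in> vecs (Hinf0 r)" "z \<in> ball 0 r"
  shows "eval_fps (fps_expansion g 0) z = g z"
  using eval_fps_expansion'[of g 0 "ereal r" z] assms by (auto simp: Hinf0_iff)

lemma Hinf0_coeff_add:
  assumes "f \<in> vecs (Hinf0 r)" "g \<in> vecs (Hinf0 r)"
  shows "fps_expansion (f + g) 0 = fps_expansion f 0 + fps_expansion g 0"
  using has_fps_expansion_add[OF Hinf0_has_fps_expansion[OF assms(1)] Hinf0_has_fps_expansion[OF assms(2)]]
  by (intro fps_expansion_eqI) (simp add: plus_fun_def)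

lemma Hinf0_coeff_scl:
  assumes "g \<in> vecs (Hinf0 r)"
  shows "fps_expansion (scl (Hinf0 r) c g) 0 = fps_const c * fps_expansion g 0"
  using has_fps_expansion_cmult_left[OF Hinf0_has_fps_expansion[OF assms], of c]
  by (intro fps_expansion_eqI) (simp add: scl_Hinf0)

text \<open>Functions in \<open>Hinf0 r\<close> need not extend continuously to the boundary circle,
  so Cauchy's inequality is applied at radii s < r and s tends to r from the left.\<close>

lemma Hinf0_coeff_bound:
  assumes g: "g \<in> vecs (Hinf0 r)"
  shows "cmod (fps_nth (fps_expansion g 0) n) * r ^ n \<le> nrm (Hinf0 r) g"
proof (rule tendsto_upperbound)
  show "((\<lambda>s. cmod (fps_nth (fps_expansion g 0) n) * s ^ n) \<longlongrightarrow>
      cmod (fps_nth (fps_expansion g 0) n) * r ^ n) (at_left r)"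
    by (intro tendsto_intros)
  have "cmod (fps_nth (fps_expansion g 0) n) * s ^ n \<le> nrm (Hinf0 r) g" if s: "0 < s" "s < r" for s
  proof -
    have hol: "g holomorphic_on ball 0 r" using g by (simp add: Hinf0_iff)
    have "norm ((deriv ^^ n) g 0) \<le> fact n * nrm (Hinf0 r) g / s ^ n"
    proof (rule Cauchy_inequality)
      show "g holomorphic_on ball 0 s"
        using hol by (rule holomorphic_on_subset) (use s in auto)
      show "continuous_on (cball 0 s) g"
        by (rule holomorphic_on_imp_continuous_on, rule holomorphic_on_subset[OF hol]) (use s in auto)
    qed (use s Hinf0_norm_ge[OF g] in auto)
    then show ?thesis
      using s by (simp add: fps_expansion_def norm_divide field_simps)
  qed
  then show "\<forall>\<^sub>F s in at_left r. cmod (fps_nth (fps_expansion g 0) n) * s ^ n \<le> nrm (Hinf0 r) g"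
    using eventually_at_left_real[OF r] by (auto elim!: eventually_mono)
qed auto

end

section \<open>The general solution\<close>

locale disk_pair =
  fixes r1 r2 :: real
  assumes r2: "0 < r2" and r21: "r2 < r1"
begin

lemma r1: "0 < r1"
  using r2 r21 by simp

sublocale two_complex_normed_spaces "Hinf0 r1" "Hinf0 r2"
  by unfold_locales (rule complex_normed_Hinf0[OF r1] complex_normed_Hinf0[OF r2])+

lemma complex_banach_L_space: "complex_banach (L_space r1 r2)"
  by (rule complex_banach_bounded_ops[OF complex_banach_Hinf0[OF r2]])

section \<open>Hadamard multipliers as bounded operators\<close>

context
  fixes A :: "complex fps" and w :: "nat \<Rightarrow> real" and W :: real
  assumes A0: "fps_nth A 0 = 0" and Aw: "\<And>n. cmod (fps_nth A n) \<le> w n"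
    and W: "(\<lambda>n. w n * (r2 / r1) ^ n) sums W"
begin

text \<open>Cauchy's estimate costs r1^(-n) and evaluation gains r2^n. The multiplier thus enters
  only through its majorant \<open>w\<close> weighted by (r2 / r1)^n, and the total \<open>W\<close>
  becomes a bound for the operator norm.\<close>

lemma hadamard_op_term:
  assumes g: "g \<in> vecs (Hinf0 r1)" and z: "cmod z \<le> r2"
  shows "cmod (fps_nth (hadamard A (fps_expansion g 0)) n * z ^ n)
    \<le> nrm (Hinf0 r1) g * (w n * (r2 / r1) ^ n)"
proof -
  have "cmod (fps_nth (fps_expansion g 0) n) \<le> nrm (Hinf0 r1) g / r1 ^ n"
    using Hinf0_coeff_bound[OF r1 g, of n] r1 by (simp add: field_simps)
  then have "cmod (fps_nth A n) * cmod (fps_nth (fps_expansion g 0) n) * cmod z ^ n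
      \<le> w n * (nrm (Hinf0 r1) g / r1 ^ n) * r2 ^ n"
    using Aw[of n] z r1 e.nrm_nonneg[OF g] order.trans[OF norm_ge_zero Aw[of n]]
    by (intro mult_mono power_mono mult_nonneg_nonneg) auto
  then show ?thesis
    by (simp add: hadamard_def norm_mult norm_power power_divide mult_ac)
qed

lemma hadamard_op_summable:
  assumes "g \<in> vecs (Hinf0 r1)" "cmod z \<le> r2"
  shows "summable (\<lambda>n. norm (fps_nth (hadamard A (fps_expansion g 0)) n * z ^ n))"
proof (rule summable_comparison_test')
  show "summable (\<lambda>n. nrm (Hinf0 r1) g * (w n * (r2 / r1) ^ n))"
    by (intro summable_mult sums_summable[OF W])
  show "norm (norm (fps_nth (hadamard A (fps_expansion g 0)) n * z ^ n))
      \<le> nrm (Hinf0 r1) g * (w n * (r2 / r1) ^ n)" if "n \<ge> 0" for n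
    using hadamard_op_term[OF assms, of n] by simp
qed

text \<open>The termwise bound includes |z| = r2, so summability at the boundary point r2 already
  gives the radius.\<close>

lemma hadamard_conv_radius:
  assumes "g \<in> vecs (Hinf0 r1)"
  shows "ereal r2 \<le> fps_conv_radius (hadamard A (fps_expansion g 0))"
  unfolding fps_conv_radius_def
  using conv_radius_geI[OF summable_norm_cancel[OF hadamard_op_summable[OF assms, of "of_real r2"]]] r2
  by simp

lemma fps_op_hadamard_eq:
  assumes "g \<in> vecs (Hinf0 r1)" "z \<in> ball 0 r2"
  shows "fps_op r1 r2 (hadamard A) g z = eval_fps (hadamard A (fps_expansion g 0)) z"
  using assms by (simp add: fps_op_def)

lemma fps_op_hadamard_bound:
  assumes g: "g \<in> vecs (Hinf0 r1)" and z: "z \<in> ball 0 r2"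
  shows "cmod (fps_op r1 r2 (hadamard A) g z) \<le> W * nrm (Hinf0 r1) g"
proof -
  have z': "cmod z \<le> r2" using z by simp
  have "cmod (fps_op r1 r2 (hadamard A) g z)
      \<le> (\<Sum>n. norm (fps_nth (hadamard A (fps_expansion g 0)) n * z ^ n))"
    unfolding fps_op_hadamard_eq[OF assms] eval_fps_def by (rule summable_norm[OF hadamard_op_summable[OF g z']])
  also have "\<dots> \<le> (\<Sum>n. nrm (Hinf0 r1) g * (w n * (r2 / r1) ^ n))"
    by (rule suminf_le[OF hadamard_op_term[OF g z'] hadamard_op_summable[OF g z'] summable_mult[OF sums_summable[OF W]]])
  also have "\<dots> = nrm (Hinf0 r1) g * W"
    using sums_unique[OF sums_mult[OF W]] by simp
  finally show ?thesis by (simp add: mult.commute)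
qed

lemma fps_op_hadamard_vec:
  assumes g: "g \<in> vecs (Hinf0 r1)"
  shows "fps_op r1 r2 (hadamard A) g \<in> vecs (Hinf0 r2)"
  unfolding Hinf0_iff[OF r2]
proof (intro conjI)
  have "eval_fps (hadamard A (fps_expansion g 0)) holomorphic_on ball 0 r2"
    using hadamard_conv_radius[OF g] by (intro holomorphic_on_eval_fps ball_eball_mono)
  then show "fps_op r1 r2 (hadamard A) g holomorphic_on ball 0 r2"
    by (rule holomorphic_transform) (rule fps_op_hadamard_eq[OF g, symmetric])
  show "bounded (fps_op r1 r2 (hadamard A) g ` ball 0 r2)"
    using fps_op_hadamard_bound[OF g] by (auto simp: bounded_iff intro!: exI[of _ "W * nrm (Hinf0 r1) g"])
  show "fps_op r1 r2 (hadamard A) g 0 = 0"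
    using r2 fps_op_hadamard_eq[OF g, of 0] by (simp add: eval_fps_at_0 hadamard_def A0)
  show "\<forall>z. z \<notin> ball 0 r2 \<longrightarrow> fps_op r1 r2 (hadamard A) g z = 0"
    by (simp add: fps_op_def)
qed

text \<open>Gives access to the Taylor coefficients of an image, on which the comparison with the
  explicit solution rests.\<close>

lemma fps_expansion_fps_op_hadamard:
  assumes g: "g \<in> vecs (Hinf0 r1)"
  shows "fps_expansion (fps_op r1 r2 (hadamard A) g) 0 = hadamard A (fps_expansion g 0)"
proof (rule fps_expansion_eqI)
  have "\<forall>\<^sub>F z in nhds 0. z \<in> ball 0 r2"
    using r2 by (intro eventually_nhds_in_open) auto
  then have "\<forall>\<^sub>F z in nhds 0. eval_fps (hadamard A (fps_expansion g 0)) z = fps_op r1 r2 (hadamard A) g z"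
    by eventually_elim (simp add: fps_op_hadamard_eq[OF g])
  moreover have "0 < fps_conv_radius (hadamard A (fps_expansion g 0))"
    using r2 by (intro less_le_trans[OF _ hadamard_conv_radius[OF g]]) simp
  ultimately show "fps_op r1 r2 (hadamard A) g has_fps_expansion hadamard A (fps_expansion g 0)"
    by (simp add: has_fps_expansion_def)
qed

lemma fps_op_hadamard_bounded_op:
  "fps_op r1 r2 (hadamard A) \<in> vecs (L_space r1 r2)"
  unfolding bounded_ops_iff
proof (intro conjI ballI allI impI)
  show "fps_op r1 r2 (hadamard A) g \<in> vecs (Hinf0 r2)" if "g \<in> vecs (Hinf0 r1)" for g
    by (rule fps_op_hadamard_vec[OF that])
  show "fps_op r1 r2 (hadamard A) g = 0" if "g \<notin> vecs (Hinf0 r1)" for g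
    using that by (simp add: fps_op_def)
  have "nrm (Hinf0 r2) (fps_op r1 r2 (hadamard A) g) \<le> W * nrm (Hinf0 r1) g"
    if "g \<in> vecs (Hinf0 r1)" for g
    by (rule Hinf0_norm_leI[OF r2 fps_op_hadamard_bound[OF that]])
  then show "\<exists>M. \<forall>g\<in>vecs (Hinf0 r1). nrm (Hinf0 r2) (fps_op r1 r2 (hadamard A) g) \<le> M * nrm (Hinf0 r1) g"
    by blast
next
  fix f g assume fg: "f \<in> vecs (Hinf0 r1)" "g \<in> vecs (Hinf0 r1)"
  show "fps_op r1 r2 (hadamard A) (f + g) = fps_op r1 r2 (hadamard A) f + fps_op r1 r2 (hadamard A) g"
  proof
    fix z
    have had: "hadamard A (F + G) = hadamard A F + hadamard A G" for F G
      by (simp add: hadamard_def fps_eq_iff distrib_left)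
    show "fps_op r1 r2 (hadamard A) (f + g) z = (fps_op r1 r2 (hadamard A) f + fps_op r1 r2 (hadamard A) g) z"
    proof (cases "z \<in> ball 0 r2")
      case True
      then have radius: "ereal (cmod z) < fps_conv_radius (hadamard A (fps_expansion h 0))"
        if "h \<in> vecs (Hinf0 r1)" for h
        using less_le_trans[OF _ hadamard_conv_radius[OF that], of "ereal (cmod z)"] by simp
      show ?thesis
        unfolding plus_fun_apply fps_op_hadamard_eq[OF fg(1) True] fps_op_hadamard_eq[OF fg(2) True]
          fps_op_hadamard_eq[OF e.vecs_add[OF fg] True] Hinf0_coeff_add[OF r1 fg] had
        by (rule eval_fps_add[OF radius[OF fg(1)] radius[OF fg(2)]])
    qed (simp add: fps_op_def)
  qed
next
  fix c g assume g: "g \<in> vecs (Hinf0 r1)"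
  show "fps_op r1 r2 (hadamard A) (scl (Hinf0 r1) c g) = scl (Hinf0 r2) c (fps_op r1 r2 (hadamard A) g)"
  proof
    fix z
    show "fps_op r1 r2 (hadamard A) (scl (Hinf0 r1) c g) z = scl (Hinf0 r2) c (fps_op r1 r2 (hadamard A) g) z"
    proof (cases "z \<in> ball 0 r2")
      case True
      have "hadamard A (fps_const c * fps_expansion g 0) = fps_const c * hadamard A (fps_expansion g 0)"
        by (simp add: hadamard_def fps_eq_iff)
      moreover have "eval_fps (fps_const c * hadamard A (fps_expansion g 0)) z = c * eval_fps (hadamard A (fps_expansion g 0)) z"
      proof -
        have "ereal (cmod z) < fps_conv_radius (hadamard A (fps_expansion g 0))"
          using less_le_trans[OF _ hadamard_conv_radius[OF g], of "ereal (cmod z)"] True by simp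
        then show ?thesis by (simp add: eval_fps_mult)
      qed
      ultimately show ?thesis
        unfolding fps_op_hadamard_eq[OF e.vecs_scl[OF g] True] Hinf0_coeff_scl[OF r1 g]
          scl_Hinf0[OF r2] fps_op_hadamard_eq[OF g True] by simp
    qed (simp add: fps_op_def scl_Hinf0[OF r2])
  qed
qed

lemma nrm_fps_op_hadamard_le: "nrm (L_space r1 r2) (fps_op r1 r2 (hadamard A)) \<le> W"
proof (rule nrm_op_leI)
  have "0 \<le> w n * (r2 / r1) ^ n" for n
    using order.trans[OF norm_ge_zero Aw[of n]] r1 r2 by simp
  then show "0 \<le> W"
    unfolding sums_unique[OF W] by (intro suminf_nonneg sums_summable[OF W])
  show "nrm (Hinf0 r2) (fps_op r1 r2 (hadamard A) g) \<le> W * nrm (Hinf0 r1) g"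
    if "g \<in> vecs (Hinf0 r1)" for g
    by (rule Hinf0_norm_leI[OF r2 fps_op_hadamard_bound[OF that]])
qed

end

end

section \<open>Power series of \<open>Lm\<close> and sums over roots of unity\<close>

lemma fps_expansion_Lm:
  assumes m: "0 < m"
  shows "fps_expansion (Lm m) 0 = Abs_fps (\<lambda>n. if 0 < n \<and> m dvd n then 1 / of_nat n else 0)"
proof (rule fps_expansion_eqI, rule has_fps_expansionI)
  have "\<forall>\<^sub>F z in nhds 0. z \<in> ball (0::complex) 1"
    by (intro eventually_nhds_in_open) auto
  then show "\<forall>\<^sub>F z in nhds 0. (\<lambda>n. fps_nth (Abs_fps (\<lambda>n. if 0 < n \<and> m dvd n then 1 / of_nat n else 0)) n * z ^ n)
      sums Lm m z"
  proof eventually_elim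
    case (elim z)
    let ?f = "\<lambda>n. fps_nth (Abs_fps (\<lambda>n. if 0 < n \<and> m dvd n then 1 / of_nat n else 0)) n * z ^ n"
    have "cmod (- (z ^ m)) < 1"
      using elim m by (simp add: norm_power power_less_one_iff)
    from sums_mult[OF Ln_series'[OF this], of "- (1 / of_nat m)"]
    have "(\<lambda>k. (z ^ m) ^ k / (of_nat m * of_nat k)) sums Lm m z"
      by (simp add: Lm_def)
    \<comment> \<open>The logarithm series lives on the multiples of m. At k = 0 division by zero
      gives 0, matching the missing constant term.\<close>
    also have "(\<lambda>k. (z ^ m) ^ k / (of_nat m * of_nat k)) = (\<lambda>k. ?f (m * k))"
      using m by (auto simp: fun_eq_iff power_mult)
    finally have "(\<lambda>k. ?f (m * k)) sums Lm m z" .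
    moreover have "strict_mono (\<lambda>k. m * k)"
      using m by (simp add: strict_mono_def)
    ultimately show ?case
      by (subst (asm) sums_mono_reindex) auto
  qed
qed

text \<open>Multiplication by a primitive root \<omega> permutes the roots and scales the sum by
  \<omega>^k, which is not 1.\<close>

lemma sum_powers_roots_unity:
  assumes "0 < k" "k < n"
  shows "(\<Sum>\<Lambda>\<in>{z::complex. z ^ n = 1}. \<Lambda> ^ k) = 0"
proof -
  define \<omega> :: complex where "\<omega> = exp (2 * of_real pi * \<i> * of_nat 1 / of_nat n)"
  have \<omega>n: "\<omega> ^ n = 1"
    using assms by (simp add: \<omega>_def flip: exp_of_nat_mult)
  have "\<omega> ^ k = exp (2 * of_real pi * \<i> * of_nat k / of_nat n)"
    by (simp add: \<omega>_def mult_ac flip: exp_of_nat_mult)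
  then have \<omega>k: "\<omega> ^ k \<noteq> 1"
    using assms complex_root_unity_eq_1[of n k] by (auto dest: dvd_imp_le)
  have "(\<Sum>\<Lambda>\<in>{z. z ^ n = 1}. \<Lambda> ^ k) = (\<Sum>\<Lambda>\<in>{z. z ^ n = 1}. (\<omega> * \<Lambda>) ^ k)"
  proof (rule sum.reindex_bij_betw[symmetric])
    have "\<omega> \<noteq> 0" by (simp add: \<omega>_def)
    then show "bij_betw (\<lambda>\<Lambda>. \<omega> * \<Lambda>) {z. z ^ n = 1} {z. z ^ n = 1}"
      by (intro bij_betwI[where g = "\<lambda>\<Lambda>. \<Lambda> / \<omega>"]) (auto simp: power_mult_distrib power_divide \<omega>n)
  qed
  also have "\<dots> = \<omega> ^ k * (\<Sum>\<Lambda>\<in>{z. z ^ n = 1}. \<Lambda> ^ k)"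
    by (simp add: power_mult_distrib sum_distrib_left)
  finally show ?thesis
    using \<omega>k by simp
qed

text \<open>Since q^n - 1 = q^n - \<Lambda>^n is divisible by q - \<Lambda>, clearing the
  denominator leaves power sums of the roots; all vanish except the one for k = 0, which counts the
  n roots.\<close>

lemma sum_roots_unity_simple_poles:
  fixes q :: complex
  assumes n: "0 < n" and q: "q ^ n \<noteq> 1"
  shows "(\<Sum>\<Lambda>\<in>{z. z ^ n = 1}. \<Lambda> / (q - \<Lambda>)) = of_nat n / (q ^ n - 1)"
proof -
  have "\<Lambda> / (q - \<Lambda>) * (q ^ n - 1) = (\<Sum>k<n. q ^ k * \<Lambda> ^ (n - k))" if \<Lambda>: "\<Lambda> ^ n = 1" for \<Lambda>
  proof -
    have "q - \<Lambda> \<noteq> 0" using \<Lambda> q by auto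
    have "q ^ n - 1 = q ^ n - \<Lambda> ^ n" by (simp add: \<Lambda>)
    also have "\<dots> = (q - \<Lambda>) * (\<Sum>k<n. q ^ k * \<Lambda> ^ (n - Suc k))"
      by (simp add: diff_power_eq_sum power_diff_sumr2 mult_ac)
    finally have "\<Lambda> / (q - \<Lambda>) * (q ^ n - 1) = \<Lambda> * (\<Sum>k<n. q ^ k * \<Lambda> ^ (n - Suc k))"
      using \<open>q - \<Lambda> \<noteq> 0\<close> by simp
    \<comment> \<open>The numerator \<Lambda> shifts the exponents to 1, ..., n, so the surviving
      one is n, at k = 0.\<close>
    also have "\<dots> = (\<Sum>k<n. q ^ k * \<Lambda> ^ (n - k))"
      unfolding sum_distrib_left
      by (rule sum.cong) (auto simp: Suc_diff_Suc simp flip: power_Suc)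
    finally show ?thesis .
  qed
  then have "(\<Sum>\<Lambda>\<in>{z. z ^ n = 1}. \<Lambda> / (q - \<Lambda>)) * (q ^ n - 1)
      = (\<Sum>\<Lambda>\<in>{z. z ^ n = 1}. \<Sum>k<n. q ^ k * \<Lambda> ^ (n - k))"
    unfolding sum_distrib_right by (intro sum.cong) auto
  also have "\<dots> = (\<Sum>k<n. q ^ k * (\<Sum>\<Lambda>\<in>{z::complex. z ^ n = 1}. \<Lambda> ^ (n - k)))"
    by (subst sum.swap) (simp add: sum_distrib_left)
  also have "\<dots> = (\<Sum>k\<in>{0}. q ^ k * (\<Sum>\<Lambda>\<in>{z::complex. z ^ n = 1}. \<Lambda> ^ (n - k)))"
    using n by (intro sum.mono_neutral_right) (auto simp: sum_powers_roots_unity)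
  also have "\<dots> = of_nat n"
    using card_roots_unity_eq[OF n] by simp
  finally show ?thesis
    using q by (simp add: eq_divide_eq)
qed

section \<open>The coefficient operators and identification of the sum with
  \<open>F_sol\<close>\<close>

context disk_pair begin

text \<open>Majorizing the coefficients of \<open>Lm m\<close> by 1 / m at every n >= m costs only
  the factor 1 / (1 - r2 / r1) and keeps the dependence on m that \<open>S_space\<close> asks
  for.\<close>

lemma Lm_weights_sums:
  assumes m: "0 < (m::nat)"
  shows "(\<lambda>n. (if m \<le> n then 1 / real m else 0) * (r2 / r1) ^ n) sums
    (1 / (1 - r2 / r1) * (r2 / r1) ^ m / real m)"
proof -
  have "(\<lambda>k. (r2 / r1) ^ k) sums (1 / (1 - r2 / r1))"
    using r1 r2 r21 by (intro geometric_sums) auto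
  then have "(\<lambda>k. (r2 / r1) ^ m / real m * (r2 / r1) ^ k) sums ((r2 / r1) ^ m / real m * (1 / (1 - r2 / r1)))"
    by (rule sums_mult)
  then have "(\<lambda>k. (if m \<le> k + m then 1 / real m else 0) * (r2 / r1) ^ (k + m)) sums
      (1 / (1 - r2 / r1) * (r2 / r1) ^ m / real m)"
    by (simp add: power_add mult_ac)
  then show ?thesis
    by (subst (asm) sums_iff_shift) simp
qed

text \<open>The coefficient of \<open>Lm m\<close> at a multiple n of m is 1 / n whatever m is. So
  all n-th roots of unity, of any order, enter coefficient n with the same weight, and the series
  there collapses to a sum of \<Lambda> / (q - \<Lambda>).\<close>

lemma
  assumes \<Lambda>: "\<Lambda> \<in> roots_of_unity"
  shows F_coeff_vec: "F_coeff r1 r2 \<Lambda> \<in> vecs (L_space r1 r2)"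
    and nrm_F_coeff_le: "nrm (L_space r1 r2) (F_coeff r1 r2 \<Lambda>)
      \<le> 1 / (1 - r2 / r1) * (r2 / r1) ^ root_order \<Lambda> / real (root_order \<Lambda>)"
    and fps_expansion_F_coeff: "\<And>g n. g \<in> vecs (Hinf0 r1) \<Longrightarrow>
      fps_nth (fps_expansion (F_coeff r1 r2 \<Lambda> g) 0) n
        = (if 0 < n \<and> \<Lambda> ^ n = 1 then \<Lambda> / of_nat n * fps_nth (fps_expansion g 0) n else 0)"
proof -
  define m where "m = root_order \<Lambda>"
  define w where "w = (\<lambda>n. if m \<le> n then 1 / real m else 0)"
  have m: "0 < m" using root_order_props[OF \<Lambda>] by (simp add: m_def)
  have w: "cmod (fps_nth (fps_expansion (Lm m) 0) n) \<le> w n" for n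
    using m by (auto simp: fps_expansion_Lm w_def norm_divide frac_le dest: dvd_imp_le)
  have A0: "fps_nth (fps_expansion (Lm m) 0) 0 = 0"
    by (simp add: fps_expansion_Lm m)
  have W: "(\<lambda>n. w n * (r2 / r1) ^ n) sums (1 / (1 - r2 / r1) * (r2 / r1) ^ m / real m)"
    using Lm_weights_sums[OF m] by (simp only: w_def)
  have norm_\<Lambda>: "cmod \<Lambda> = 1"
    using root_order_props[OF \<Lambda>] by (metis gr_implies_not0 norm_one norm_power power_eq_1_iff norm_ge_zero)
  note op = fps_op_hadamard_bounded_op[OF A0 w W]
  show "F_coeff r1 r2 \<Lambda> \<in> vecs (L_space r1 r2)"
    unfolding F_coeff_def m_def[symmetric] by (rule op.vecs_scl[OF op])
  show "nrm (L_space r1 r2) (F_coeff r1 r2 \<Lambda>)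
      \<le> 1 / (1 - r2 / r1) * (r2 / r1) ^ root_order \<Lambda> / real (root_order \<Lambda>)"
    using nrm_fps_op_hadamard_le[OF A0 w W]
    unfolding F_coeff_def m_def[symmetric] op.nrm_scl[OF op] norm_\<Lambda> by simp
  fix g n assume g: "g \<in> vecs (Hinf0 r1)"
  have "fps_expansion (F_coeff r1 r2 \<Lambda> g) 0
      = fps_const \<Lambda> * hadamard (fps_expansion (Lm m) 0) (fps_expansion g 0)"
    unfolding F_coeff_def m_def[symmetric] scl_bounded_ops
      Hinf0_coeff_scl[OF r2 fps_op_hadamard_vec[OF A0 w W g]]
      fps_expansion_fps_op_hadamard[OF A0 w W g] ..
  then show "fps_nth (fps_expansion (F_coeff r1 r2 \<Lambda> g) 0) n
      = (if 0 < n \<and> \<Lambda> ^ n = 1 then \<Lambda> / of_nat n * fps_nth (fps_expansion g 0) n else 0)"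
    using root_order_dvd_iff[OF \<Lambda>, of n, folded m_def] by (simp add: hadamard_def fps_expansion_Lm[OF m])
qed

text \<open>With radius r2 / r1, the condition r2 < r1 e^(-3 \<alpha>) is the one on r in the
  general statement.\<close>

lemma F_coeff_S_space: "F_coeff r1 r2 \<in> S_space (r2 / r1) (L_space r1 r2)"
  unfolding S_space_def
  using F_coeff_vec nrm_F_coeff_le r1 r2 r21
  by (auto intro!: exI[of _ "1 / (1 - r2 / r1)"] simp: field_simps)

text \<open>Taylor coefficients are bounded functionals, and only the finitely many \<open>\<Lambda>\<close> with \<open>\<Lambda> ^ n = 1\<close>
  contribute to the coefficient of index \<open>n\<close>.\<close>

lemma F_sol_eq_bwd_sum:
  assumes q: "cmod q \<noteq> 1" and S: "bwd_has_sum (L_space r1 r2) (F_coeff r1 r2) q S"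
  shows "F_sol r1 r2 q = S"
proof -
  have S': "op.has_nsum (\<lambda>\<Lambda>. scl (L_space r1 r2) (1 / (q - \<Lambda>)) (F_coeff r1 r2 \<Lambda>)) roots_of_unity S"
    using S op.bwd_has_sum_iff[of "F_coeff r1 r2", OF F_coeff_vec] by blast
  have Sv: "S \<in> vecs (L_space r1 r2)"
    using S' by (simp add: op.has_nsum_def)
  have qn: "q ^ n \<noteq> 1" if "0 < n" for n
    using q that by (metis gr_implies_not0 norm_one norm_power power_eq_1_iff norm_ge_zero)
  have coeff: "fps_nth (fps_expansion (S g) 0) n = fps_nth (fps_expansion g 0) n / (q ^ n - 1)"
    if g: "g \<in> vecs (Hinf0 r1)" and n: "0 < n" for g n
  proof -
    \<comment> \<open>Evaluation at \<open>g\<close> followed by Cauchy's estimate on the disk of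
      radius r2 bounds this functional.\<close>
    define \<phi> where "\<phi> T = fps_nth (fps_expansion (T g) 0) n" for T :: "(complex \<Rightarrow> complex) \<Rightarrow> complex \<Rightarrow> complex"
    have vec: "T g \<in> vecs (Hinf0 r2)" if "T \<in> vecs (L_space r1 r2)" for T
      using that g by (simp add: bounded_ops_iff)
    have "((\<lambda>\<Lambda>. \<phi> (scl (L_space r1 r2) (1 / (q - \<Lambda>)) (F_coeff r1 r2 \<Lambda>))) has_sum \<phi> S) roots_of_unity"
    proof (rule op.has_sum_functional[OF _ S'])
      fix T assume T: "T \<in> vecs (L_space r1 r2)"
      have "cmod (\<phi> T) \<le> nrm (Hinf0 r2) (T g) / r2 ^ n"
        using Hinf0_coeff_bound[OF r2 vec[OF T], of n] r2 by (simp add: \<phi>_def field_simps)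
      also have "\<dots> \<le> nrm (L_space r1 r2) T * nrm (Hinf0 r1) g / r2 ^ n"
        using nrm_op_le[OF T g] r2 by (intro divide_right_mono) auto
      finally show "cmod (\<phi> T) \<le> nrm (Hinf0 r1) g / r2 ^ n * nrm (L_space r1 r2) T"
        by (simp add: mult_ac)
    next
      fix T U assume "T \<in> vecs (L_space r1 r2)" "U \<in> vecs (L_space r1 r2)"
      then show "\<phi> (T + U) = \<phi> T + \<phi> U"
        by (simp add: \<phi>_def Hinf0_coeff_add[OF r2 vec vec])
    qed (use F_coeff_vec in auto)
    moreover have "\<phi> (scl (L_space r1 r2) (1 / (q - \<Lambda>)) (F_coeff r1 r2 \<Lambda>))
        = (if \<Lambda> ^ n = 1 then \<Lambda> / (q - \<Lambda>) * (fps_nth (fps_expansion g 0) n / of_nat n) else 0)"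
      if "\<Lambda> \<in> roots_of_unity" for \<Lambda>
      using n by (simp add: \<phi>_def Hinf0_coeff_scl[OF r2 vec[OF F_coeff_vec[OF that]]]
          fps_expansion_F_coeff[OF that g])
    moreover have "{z. z ^ n = 1} \<subseteq> roots_of_unity"
      using n by (auto simp: roots_of_unity_def intro!: exI[of _ n])
    ultimately have "((\<lambda>\<Lambda>. \<Lambda> / (q - \<Lambda>) * (fps_nth (fps_expansion g 0) n / of_nat n)) has_sum \<phi> S) {z. z ^ n = 1}"
      by (subst has_sum_cong_neutral[where S = roots_of_unity
            and f = "\<lambda>\<Lambda>. \<phi> (scl (L_space r1 r2) (1 / (q - \<Lambda>)) (F_coeff r1 r2 \<Lambda>))", symmetric]) auto
    then have "\<phi> S = (\<Sum>\<Lambda>\<in>{z. z ^ n = 1}. \<Lambda> / (q - \<Lambda>) * (fps_nth (fps_expansion g 0) n / of_nat n))"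
      using has_sum_finite[of "{z::complex. z ^ n = 1}"] finite_roots_unity[of n, where ?'a = complex] n
      by (auto intro: has_sum_unique)
    also have "\<dots> = (\<Sum>\<Lambda>\<in>{z. z ^ n = 1}. \<Lambda> / (q - \<Lambda>)) * (fps_nth (fps_expansion g 0) n / of_nat n)"
      by (rule sum_distrib_right[symmetric])
    also have "\<dots> = fps_nth (fps_expansion g 0) n / (q ^ n - 1)"
      using n by (simp add: sum_roots_unity_simple_poles[OF n qn[OF n]])
    finally show ?thesis by (simp add: \<phi>_def)
  qed
  show ?thesis
  proof (intro ext)
    fix g z
    show "F_sol r1 r2 q g z = S g z"
    proof (cases "g \<in> vecs (Hinf0 r1)")
      case g: True
      have Sg: "S g \<in> vecs (Hinf0 r2)"
        using Sv g by (simp add: bounded_ops_iff)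
      \<comment> \<open>The coefficient of index 0 is not covered by \<open>coeff\<close>; it
        vanishes because \<open>S g\<close> is 0 at the origin.\<close>
      have "fps_expansion (S g) 0
          = Abs_fps (\<lambda>n. if n = 0 then 0 else fps_nth (fps_expansion g 0) n / (q ^ n - 1))"
        using coeff[OF g] Sg by (auto simp: fps_eq_iff fps_expansion_def Hinf0_iff[OF r2])
      then show ?thesis
        using g q Hinf0_eval_fps[OF r2 Sg, of z] Sg by (auto simp: F_sol_def fps_op_def Hinf0_iff[OF r2])
    next
      case False
      then show ?thesis
        using Sv q by (simp add: F_sol_def fps_op_def bounded_ops_iff)
    qed
  qed
qed

end

theorem theorem2p2:
  fixes \<kappa> d \<alpha> :: real and \<gamma> :: "nat \<Rightarrow> real" and B :: "'b::ab_group_add nspace"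
  assumes "0 < \<kappa>" and "\<kappa> < 1" and "0 < d" and "0 < \<alpha>"
    and "decseq \<gamma>" and "\<gamma> \<longlonglongrightarrow> 0" and "\<And>j. 0 < \<gamma> j"
    and "\<And>j. \<gamma> j < Min {\<alpha> * exp 1 / 2, (exp \<alpha> - 1) / 2, 1}"
    and "complex_banach B"
  defines "K \<equiv> K_set \<kappa> d \<alpha> \<gamma>"
  shows "(\<forall>r a. 0 < r \<and> r < exp (- 3 * \<alpha>) \<and> a \<in> S_space r B \<longrightarrow>
            (\<forall>q\<in>(\<Union>j. K j). \<exists>s. bwd_has_sum B a q s) \<and>
            bwd_sum B a \<in> monogenic K B) \<and>
         (\<forall>r1 r2. 0 < r2 \<and> r2 < r1 * exp (- 3 * \<alpha>) \<longrightarrow>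
            (\<forall>q\<in>(\<Union>j. K j). bwd_has_sum (L_space r1 r2) (F_coeff r1 r2) q (F_sol r1 r2 q)) \<and>
            F_sol r1 r2 \<in> monogenic K (L_space r1 r2))"
proof (intro conjI allI impI; (elim conjE)?)
  fix r a assume r: "0 < r" "r < exp (- 3 * \<alpha>)" and a: "a \<in> S_space r B"
  interpret complex_normed_space B
    by unfold_locales (use \<open>complex_banach B\<close> in \<open>simp add: complex_banach_def\<close>)
  note series = bwd_series_K_set[where \<gamma> = \<gamma>, OF \<open>complex_banach B\<close> \<open>0 < \<kappa>\<close> \<open>0 < \<alpha>\<close> \<open>\<And>j. 0 < \<gamma> j\<close> r a]
  have ex: "\<exists>s. bwd_has_sum B a q s" if "q \<in> K j" for q j
    using series(1) that by (simp add: K_def)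
  then show "\<forall>q\<in>(\<Union>j. K j). \<exists>s. bwd_has_sum B a q s"
    by blast
  have av: "a \<Lambda> \<in> vecs B" if "\<Lambda> \<in> roots_of_unity" for \<Lambda>
    using a that by (auto simp: S_space_def)
  have "bwd_has_sum B a q (bwd_sum B a q)" if q: "q \<in> K j" for q j
  proof -
    obtain s where s: "bwd_has_sum B a q s" using ex[OF q] by blast
    from bwd_sum_eqI[OF av s] s show ?thesis by simp
  qed
  then show "bwd_sum B a \<in> monogenic K B"
    unfolding monogenic_def using series(2) by (simp add: K_def)
next
  fix r1 r2 :: real assume pos: "0 < r2" and less: "r2 < r1 * exp (- 3 * \<alpha>)"
  then have "0 < r1"
    by (metis exp_gt_zero order.strict_trans zero_less_mult_pos2)
  \<comment> \<open>This supplies r2 < r1, required by \<open>disk_pair\<close>.\<close>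
  have "r1 * exp (- 3 * \<alpha>) \<le> r1 * 1"
    using \<open>0 < r1\<close> \<open>0 < \<alpha>\<close> by (intro mult_left_mono) auto
  then interpret disk_pair r1 r2
    using pos less by unfold_locales auto
  have \<rho>: "0 < r2 / r1" "r2 / r1 < exp (- 3 * \<alpha>)"
    using r1 pos less by (simp_all add: divide_less_eq mult.commute)
  note series = op.bwd_series_K_set[where \<gamma> = \<gamma>, OF complex_banach_L_space \<open>0 < \<kappa>\<close> \<open>0 < \<alpha>\<close> \<open>\<And>j. 0 < \<gamma> j\<close> \<rho> F_coeff_S_space]
  have sum: "bwd_has_sum (L_space r1 r2) (F_coeff r1 r2) q (F_sol r1 r2 q)" if q: "q \<in> K j" for q j
  proof -
    obtain S where S: "bwd_has_sum (L_space r1 r2) (F_coeff r1 r2) q S"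
      using series(1)[of q d] q unfolding K_def by blast
    have "F_sol r1 r2 q = S"
    \<comment> \<open>On the circle \<open>F_sol\<close> is \<open>bwd_sum\<close>, so uniqueness of
      the limit suffices; elsewhere Taylor coefficients are compared.\<close>
    proof (cases "cmod q = 1")
      case True
      then show ?thesis
        using op.bwd_sum_eqI[OF F_coeff_vec S] by (simp add: F_sol_def)
    qed (rule F_sol_eq_bwd_sum[OF _ S])
    with S show ?thesis by simp
  qed
  then show "\<forall>q\<in>(\<Union>j. K j). bwd_has_sum (L_space r1 r2) (F_coeff r1 r2) q (F_sol r1 r2 q)"
    by blast
  show "F_sol r1 r2 \<in> monogenic K (L_space r1 r2)"
    unfolding monogenic_def using series(2) sum by (simp add: K_def)
qed

end
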